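(* Let $N,K\ge1$ be integers. For the coded caching problem with private demands and caches with $N$ files and $K$ users, the minimum achievable load $R^\star$, as a function of the memory size $M$, is upper bounded by the lower convex envelope of the memory-load points $$(M,R)=\left(\frac tK,\ \frac{\binom{NK}{t+1}-\binom{NK-N}{t+1}}{\binom{NK}{t}}\right),\qquad t\in\{0,1,\dots,NK\}.$$
   Context: **Coded caching with private demands and caches.** A server holds $N$ independent files $W_1,\dots,W_N$ of $F$ bits each and is connected to $K$ users by an error-free shared broadcast link. Placement: user $k$ stores $Z_k=\phi_k(W_1,\dots,W_N,\mathcal M_k)$, where the metadata $\mathcal M_k$ (describing the composition of $Z_k$) is a random variable known only to the server and user $k$ and contained in $Z_k$; the memory constraint is $H(Z_k)\le MF$ for all $k$. Delivery: user $k$ requests $W_{d_k}$, with $d_1,\dots,d_K$ i.i.d. uniform on $\{1,\dots,N\}$, $\mathbf d=(d_1,\dots,d_K)$; the server broadcasts $X_{\mathbf d}=\psi(\mathbf d,W_1,\dots,W_N,\mathcal M_1,\dots,\mathcal M_K)$. It is assumed that $H(W_1,\dots,W_N,\mathcal M_1,\dots,\mathcal M_K,\mathbf d)=NF+H(\mathcal M_1,\dots,\mathcal M_K)+\sum_kH(d_k)$. Decodability: $H(W_{d_k}\mid d_k,Z_k,X_{\mathbf d})=0$ for all $k$. Demand privacy: $I(\mathbf d;X_{\mathbf d}\mid d_k,Z_k)=0$ for all $k$. Cache privacy: $I((\mathcal M_1,\dots,\mathcal M_K);X_{\mathbf d}\mid d_k,Z_k)=0$ for all $k$. The load $R$ is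 achievable (for given $M$) if there are functions $\phi_k$, $\psi$ and decoders satisfying all these constraints with $H(X_{\mathbf d})/F\le R$; $R^\star$ is the minimum achievable load for given $M,N,K$. The file size $F$ is taken sufficiently large that the size of metadata (of the caches and of the broadcast message, the latter being included in the message) is negligible with respect to $F$. Binomial coefficients $\binom ab$ with $b>a$ are $0$. *)

theory Defs
  imports "HOL-Probability.Probability"
begin

text \<open>
  Files and users are indexed by \<open>{..<N}\<close> and \<open>{..<K}\<close>. Files are bit strings; metadata, cache
  contents and broadcast messages take finitely many values and, as any finite alphabet embeds
  into the bit strings, are bit strings (of arbitrary length) as well. Entropies are in bits.
\<close>

definition tuple :: "nat \<Rightarrow> (nat \<Rightarrow> 'a \<Rightarrow> 'b) \<Rightarrow> 'a \<Rightarrow> 'b list" where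
  "tuple n V \<omega> = map (\<lambda>i. V i \<omega>) [0..<n]"

locale caching_system = information_space P 2
  for P :: "'a measure" +
  fixes N K F :: nat
    and W :: "nat \<Rightarrow> 'a \<Rightarrow> bool list"
    and meta :: "nat \<Rightarrow> 'a \<Rightarrow> bool list"
    and d :: "nat \<Rightarrow> 'a \<Rightarrow> nat"
    and \<phi> :: "nat \<Rightarrow> bool list list \<Rightarrow> bool list \<Rightarrow> bool list"
    and \<psi> :: "nat list \<Rightarrow> bool list list \<Rightarrow> bool list list \<Rightarrow> bool list"
begin

text \<open>As \<open>entropy_Pow\<close>, \<open>conditional_entropy_Pow\<close> and \<open>conditional_mutual_information_Pow\<close>, whose
  notation is not inherited by this instance.\<close>

abbreviation Ent :: "('a \<Rightarrow> 'b) \<Rightarrow> real" where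
  "Ent X \<equiv> entropy 2 (count_space (X ` space P)) X"

abbreviation cond_Ent :: "('a \<Rightarrow> 'b) \<Rightarrow> ('a \<Rightarrow> 'c) \<Rightarrow> real" where
  "cond_Ent X Y \<equiv>
     conditional_entropy 2 (count_space (X ` space P)) (count_space (Y ` space P)) X Y"

abbreviation cond_Info :: "('a \<Rightarrow> 'b) \<Rightarrow> ('a \<Rightarrow> 'c) \<Rightarrow> ('a \<Rightarrow> 'e) \<Rightarrow> real" where
  "cond_Info X Y Z \<equiv>
     conditional_mutual_information 2 (count_space (X ` space P)) (count_space (Y ` space P))
       (count_space (Z ` space P)) X Y Z"

abbreviation files :: "'a \<Rightarrow> bool list list" where
  "files \<equiv> tuple N W"

abbreviation metadata :: "'a \<Rightarrow> bool list list" where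
  "metadata \<equiv> tuple K meta"

abbreviation demands :: "'a \<Rightarrow> nat list" where
  "demands \<equiv> tuple K d"

definition cache :: "nat \<Rightarrow> 'a \<Rightarrow> bool list" where
  "cache k \<omega> = \<phi> k (files \<omega>) (meta k \<omega>)"

definition broadcast :: "'a \<Rightarrow> bool list" where
  "broadcast \<omega> = \<psi> (demands \<omega>) (files \<omega>) (metadata \<omega>)"

end

locale private_caching_scheme = caching_system +
  fixes mem load :: real
  assumes files_indep: "indep_vars (\<lambda>_. count_space {w. length w = F}) W {..<N}"
    and metadata_simple: "\<And>k. k < K \<Longrightarrow> simple_function P (meta k)"
    and demands_indep: "indep_vars (\<lambda>_. count_space {..<N}) d {..<K}"
    and demands_uniform:
      "\<And>k. k < K \<Longrightarrow> distr P (count_space {..<N}) (d k) = uniform_count_measure {..<N}"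
    and joint_entropy:
      "Ent (\<lambda>\<omega>. (files \<omega>, metadata \<omega>, demands \<omega>)) =
         real N * real F + Ent metadata + (\<Sum>k<K. Ent (d k))"
    and metadata_in_cache:
      "\<And>k. k < K \<Longrightarrow> \<exists>g. \<forall>\<omega>\<in>space P. meta k \<omega> = g (cache k \<omega>)"
    and decodability:
      "\<And>k. k < K \<Longrightarrow>
         cond_Ent (\<lambda>\<omega>. W (d k \<omega>) \<omega>) (\<lambda>\<omega>. (d k \<omega>, cache k \<omega>, broadcast \<omega>)) = 0"
    and demand_privacy:
      "\<And>k. k < K \<Longrightarrow> cond_Info demands broadcast (\<lambda>\<omega>. (d k \<omega>, cache k \<omega>)) = 0"
    and cache_privacy:
      "\<And>k. k < K \<Longrightarrow> cond_Info metadata broadcast (\<lambda>\<omega>. (d k \<omega>, cache k \<omega>)) = 0"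
    and memory_constraint: "\<And>k. k < K \<Longrightarrow> Ent (cache k) \<le> mem * real F"
    and load_constraint: "Ent broadcast / real F \<le> load"

text \<open>
  An outcome lists the values of the files, the metadata and the demands. The joint law of these
  finitely valued variables can always be realised on this sample space.
\<close>

type_synonym outcome = "bool list list \<times> bool list list \<times> nat list"

text \<open>
  The metadata is part of the caches and of the message, so it counts in the entropies above, but
  it is negligible relative to \<open>F\<close>: memory and load only have to be met up to an arbitrarily
  small \<open>\<epsilon>\<close>, for all sufficiently large \<open>F\<close>.
\<close>

definition achievable_load :: "nat \<Rightarrow> nat \<Rightarrow> real \<Rightarrow> real \<Rightarrow> bool" where
  "achievable_load N K mem R \<longleftrightarrow>
     (\<forall>\<epsilon>>0. \<forall>\<^sub>F F in sequentially.
        \<exists>(P :: outcome measure) W meta d \<phi> \<psi>.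
          private_caching_scheme P N K F W meta d \<phi> \<psi> (mem + \<epsilon>) (R + \<epsilon>))"

text \<open>
  Achievability is closed under limits of loads, so the infimum is attained whenever some load is
  achievable; it is \<open>\<infinity>\<close> if there is none.
\<close>

definition minimum_load :: "nat \<Rightarrow> nat \<Rightarrow> real \<Rightarrow> ereal" where
  "minimum_load N K mem = (INF R\<in>{R. achievable_load N K mem R}. ereal R)"

text \<open>The lower boundary of the convex hull; \<open>\<infinity>\<close> where the hull has no point above \<open>x\<close>.\<close>

definition lower_convex_envelope :: "(real \<times> real) set \<Rightarrow> real \<Rightarrow> ereal" where
  "lower_convex_envelope S x = (INF y\<in>{y. (x, y) \<in> convex hull S}. ereal y)"

end

theory Submission
  imports Defs
begin

text \<open>
  Each user draws a secret key \<open>s < N\<close> and behaves like one of \<open>N\<close> virtual users in its stack. The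
  server announces for each stack a shift determined by demand and key, under which the virtual
  users of the stack request all \<open>N\<close> files once, and serves the \<open>N * K\<close> virtual users with the
  scheme of Yu, Maddah-Ali and Avestimehr, with the first stack as leaders. Since demand and key
  are independent and uniform, the shift is independent of each of them separately, and it
  together with the files determines the broadcast; this gives both kinds of privacy.
  Decodability is a parity argument: two samples that agree on everything a user sees also agree on
  the file it requested. The convex hull is reached by splitting the files.
\<close>

section \<open>Uniform finite sample spaces\<close>

text \<open>In coded caching with demand-dependent leaders, the choice of leaders and of the
  redundant messages reveals which users share a demand. A stack of N virtual users removes this
  dependence: its requests are a permutation of all files for every shift. So one fixed stack is a
  leader set for all demand vectors, and exactly the groups that avoid its N members are redundant,
  whence the subtracted binomial in the load.

  About the demand and key of another stack a user learns only their shift. For each demand exactly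
  one key gives this shift, and conversely, so either can be exchanged while everything visible
  stays the same. On a uniform sample space this is a statement about cardinalities, proved by a
  bijection of pairs of outcomes without computing any law.

  Privacy and decodability must hold exactly; only memory and load have slack. The key, the
  announced shifts and the bits lost by rounding cost a number of bits bounded independently of F,
  which the slack absorbs.\<close>

locale uniform_sample =
  fixes \<Omega> :: "'a set"
  assumes finite_sample: "finite \<Omega>" and sample_nonempty: "\<Omega> \<noteq> {}"
begin

abbreviation P where "P \<equiv> uniform_count_measure \<Omega>"

lemma space_P: "space P = \<Omega>"
  by (simp add: space_uniform_count_measure)

lemma sets_P: "sets P = Pow \<Omega>"
  by (simp add: sets_uniform_count_measure)

lemma card_sample_pos: "0 < card \<Omega>"
  using finite_sample sample_nonempty by (simp add: card_gt_0_iff)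

sublocale information_space P 2
proof -
  interpret prob_space P
    using finite_sample sample_nonempty by (rule prob_space_uniform_count_measure)
  show "information_space P 2" by unfold_locales simp
qed

lemma prob_eq: "prob {\<omega> \<in> \<Omega>. Q \<omega>} = card {\<omega> \<in> \<Omega>. Q \<omega>} / card \<Omega>"
  using finite_sample by (subst measure_uniform_count_measure) auto

lemma simple_function_P: "simple_function P X"
  using finite_sample by (auto simp: simple_function_def space_P sets_P)

lemma simple_distributed_P:
  "simple_distributed P X (\<lambda>x. card {\<omega> \<in> \<Omega>. X \<omega> = x} / card \<Omega>)"
proof (rule simple_distributedI[OF simple_function_P])
  fix x
  have "X -` {x} \<inter> space P = {\<omega> \<in> \<Omega>. X \<omega> = x}" by (auto simp: space_P)
  then show "card {\<omega> \<in> \<Omega>. X \<omega> = x} / card \<Omega> = prob (X -` {x} \<inter> space P)"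
    by (simp add: prob_eq)
qed simp

lemma entropy_le_log_card:
  assumes "finite A" "X ` \<Omega> \<subseteq> A"
  shows "entropy 2 (count_space (X ` space P)) X \<le> log 2 (card A)"
proof -
  have "entropy 2 (count_space (X ` space P)) X \<le> log 2 (card (X ` space P))"
    using simple_distributed_P by (rule entropy_le_card)
  also have "\<dots> \<le> log 2 (card A)"
    using assms finite_sample sample_nonempty
    by (intro log_mono) (auto simp: space_P card_gt_0_iff intro!: card_mono)
  finally show ?thesis .
qed

text \<open>When \<open>Y\<close> determines \<open>X\<close>, the joint fibres coincide with the
  fibres of \<open>Y\<close>, so every conditional probability in the sum is 1 and its logarithm
  vanishes.\<close>

lemma conditional_entropy_eq_0:
  assumes "\<And>\<omega> \<omega>'. \<omega> \<in> \<Omega> \<Longrightarrow> \<omega>' \<in> \<Omega> \<Longrightarrow> Y \<omega> = Y \<omega>' \<Longrightarrow> X \<omega> = X \<omega>'"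
  shows "conditional_entropy 2 (count_space (X ` space P)) (count_space (Y ` space P)) X Y = 0"
proof -
  have "{\<omega> \<in> \<Omega>. (X \<omega>, Y \<omega>) = (X \<xi>, Y \<xi>)} = {\<omega> \<in> \<Omega>. Y \<omega> = Y \<xi>}" if "\<xi> \<in> \<Omega>" for \<xi>
    using assms that by blast
  then show ?thesis
    using finite_sample
    by (subst conditional_entropy_eq[OF simple_distributed_P simple_distributed_P])
       (auto simp: space_P intro!: sum.neutral)
qed

text \<open>The two samples exchange the parts that determine \<open>X\<close> and \<open>Y\<close>; as this is an involution on
  the pairs with equal \<open>Z\<close>, it yields \<open>p(x, y, z) p(z) = p(x, z) p(y, z)\<close>.\<close>

lemma conditional_mutual_information_eq_0:
  assumes mem: "\<And>\<omega> \<omega>'. \<omega> \<in> \<Omega> \<Longrightarrow> \<omega>' \<in> \<Omega> \<Longrightarrow> Z \<omega> = Z \<omega>' \<Longrightarrow> \<sigma> \<omega> \<omega>' \<in> \<Omega>"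
    and Z: "\<And>\<omega> \<omega>'. \<omega> \<in> \<Omega> \<Longrightarrow> \<omega>' \<in> \<Omega> \<Longrightarrow> Z \<omega> = Z \<omega>' \<Longrightarrow> Z (\<sigma> \<omega> \<omega>') = Z \<omega>"
    and X: "\<And>\<omega> \<omega>'. \<omega> \<in> \<Omega> \<Longrightarrow> \<omega>' \<in> \<Omega> \<Longrightarrow> Z \<omega> = Z \<omega>' \<Longrightarrow> X (\<sigma> \<omega> \<omega>') = X \<omega>"
    and Y: "\<And>\<omega> \<omega>'. \<omega> \<in> \<Omega> \<Longrightarrow> \<omega>' \<in> \<Omega> \<Longrightarrow> Z \<omega> = Z \<omega>' \<Longrightarrow> Y (\<sigma> \<omega> \<omega>') = Y \<omega>'"
    and inv: "\<And>\<omega> \<omega>'. \<omega> \<in> \<Omega> \<Longrightarrow> \<omega>' \<in> \<Omega> \<Longrightarrow> Z \<omega> = Z \<omega>' \<Longrightarrow> \<sigma> (\<sigma> \<omega> \<omega>') (\<sigma> \<omega>' \<omega>) = \<omega>"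
  shows "conditional_mutual_information 2 (count_space (X ` space P)) (count_space (Y ` space P))
    (count_space (Z ` space P)) X Y Z = 0"
proof -
  let ?Pxyz = "\<lambda>x y z. {\<omega> \<in> \<Omega>. (X \<omega>, Y \<omega>, Z \<omega>) = (x, y, z)}"
  let ?Pxz = "\<lambda>x z. {\<omega> \<in> \<Omega>. (X \<omega>, Z \<omega>) = (x, z)}"
  let ?Pyz = "\<lambda>y z. {\<omega> \<in> \<Omega>. (Y \<omega>, Z \<omega>) = (y, z)}"
  let ?Pz = "\<lambda>z. {\<omega> \<in> \<Omega>. Z \<omega> = z}"
  have eq: "card (?Pxyz x y z) * card (?Pz z) = card (?Pxz x z) * card (?Pyz y z)" for x y z
  proof -
    let ?s = "\<lambda>(\<omega>, \<omega>'). (\<sigma> \<omega> \<omega>', \<sigma> \<omega>' \<omega>)"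
    have "bij_betw ?s (?Pxyz x y z \<times> ?Pz z) (?Pxz x z \<times> ?Pyz y z)"
    proof (rule bij_betw_byWitness[where f' = ?s])
      show "\<forall>p \<in> ?Pxyz x y z \<times> ?Pz z. ?s (?s p) = p" "\<forall>p \<in> ?Pxz x z \<times> ?Pyz y z. ?s (?s p) = p"
        using inv by fastforce+
      show "?s ` (?Pxyz x y z \<times> ?Pz z) \<subseteq> ?Pxz x z \<times> ?Pyz y z"
      proof (rule image_subsetI)
        fix p assume "p \<in> ?Pxyz x y z \<times> ?Pz z"
        then obtain \<omega> \<omega>' where "p = (\<omega>, \<omega>')" "\<omega> \<in> \<Omega>" "\<omega>' \<in> \<Omega>" "X \<omega> = x" "Y \<omega> = y" "Z \<omega> = z" "Z \<omega>' = z"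
          by (cases p) auto
        then show "?s p \<in> ?Pxz x z \<times> ?Pyz y z"
          using mem[of \<omega> \<omega>'] Z[of \<omega> \<omega>'] X[of \<omega> \<omega>'] mem[of \<omega>' \<omega>] Z[of \<omega>' \<omega>] Y[of \<omega>' \<omega>] by simp
      qed
      show "?s ` (?Pxz x z \<times> ?Pyz y z) \<subseteq> ?Pxyz x y z \<times> ?Pz z"
      proof (rule image_subsetI)
        fix p assume "p \<in> ?Pxz x z \<times> ?Pyz y z"
        then obtain \<omega> \<omega>' where "p = (\<omega>, \<omega>')" "\<omega> \<in> \<Omega>" "\<omega>' \<in> \<Omega>" "X \<omega> = x" "Y \<omega>' = y" "Z \<omega> = z" "Z \<omega>' = z"
          by (cases p) auto
        then show "?s p \<in> ?Pxyz x y z \<times> ?Pz z"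
          using mem[of \<omega> \<omega>'] Z[of \<omega> \<omega>'] X[of \<omega> \<omega>'] Y[of \<omega> \<omega>'] mem[of \<omega>' \<omega>] Z[of \<omega>' \<omega>] by simp
      qed
    qed
    from bij_betw_same_card[OF this] show ?thesis
      by (simp only: card_cartesian_product)
  qed
  \<comment> \<open>An empty fibre makes the quotient 0, and \<open>log 2 0 = 0\<close>; otherwise
    the counting identity makes it 1.\<close>
  have log_eq: "log 2 (real a / n / (real b / n * (real c / n / (real d / n)))) = 0"
    if "a * d = b * c" "n > 0" for a b c d :: nat and n :: real
  proof -
    have "real a * real d = real b * real c"
      using that(1) by (metis of_nat_mult)
    then have "real a / n / (real b / n * (real c / n / (real d / n))) \<in> {0, 1}"
      using that(2) by (simp add: divide_simps)
    then show ?thesis by (auto simp: log_def)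
  qed
  show ?thesis
    unfolding conditional_mutual_information_eq[OF simple_distributed_P simple_distributed_P
        simple_distributed_P simple_distributed_P]
  proof (rule sum.neutral, rule ballI, unfold split_paired_all prod.case)
    have n: "real (card \<Omega>) > 0" using card_sample_pos by simp
    show "real (card (?Pxyz x y z)) / card \<Omega> * log 2 (real (card (?Pxyz x y z)) / card \<Omega> /
      (real (card (?Pxz x z)) / card \<Omega> * (real (card (?Pyz y z)) / card \<Omega> / (real (card (?Pz z)) / card \<Omega>)))) = 0"
      for x y z
      unfolding log_eq[OF eq n] by simp
  qed
qed

text \<open>Cross-multiplied and stated for all subsets, so that for a projection of a product set
  it is a plain identity between products of cardinalities.\<close>

definition equidistributed :: "('a \<Rightarrow> 'b) \<Rightarrow> 'b set \<Rightarrow> bool" where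
  "equidistributed V A \<longleftrightarrow> finite A \<and> V ` \<Omega> \<subseteq> A \<and>
     (\<forall>T\<subseteq>A. card {\<omega> \<in> \<Omega>. V \<omega> \<in> T} * card A = card T * card \<Omega>)"

lemma equidistributed_prob:
  assumes "equidistributed V A" "T \<subseteq> A"
  shows "prob {\<omega> \<in> \<Omega>. V \<omega> \<in> T} = card T / card A"
proof -
  have "card A > 0"
    using assms sample_nonempty by (auto simp: equidistributed_def card_gt_0_iff)
  moreover have "real (card {\<omega> \<in> \<Omega>. V \<omega> \<in> T}) * card A = card T * card \<Omega>"
    using assms unfolding equidistributed_def by (metis of_nat_mult)
  ultimately show ?thesis
    using card_sample_pos by (simp add: prob_eq frac_eq_eq)
qed

lemma equidistributed_measurable:
  assumes "equidistributed V A"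
  shows "V \<in> measurable P (count_space A)"
  using assms by (auto simp: measurable_def equidistributed_def space_P sets_P)

lemma equidistributed_distr:
  assumes "equidistributed V A"
  shows "distr P (count_space A) V = uniform_count_measure A"
proof (rule measure_eqI)
  fix T assume "T \<in> sets (distr P (count_space A) V)"
  then have T: "T \<subseteq> A" by simp
  have *: "V -` T \<inter> space P = {\<omega> \<in> \<Omega>. V \<omega> \<in> T}" by (auto simp: space_P)
  have "finite A" using assms by (simp add: equidistributed_def)
  then have "emeasure (uniform_count_measure A) T = ennreal (card T / card A)"
    using T by (simp add: emeasure_uniform_count_measure)
  then show "emeasure (distr P (count_space A) V) T = emeasure (uniform_count_measure A) T"
    using T equidistributed_measurable[OF assms] equidistributed_prob[OF assms T]
    by (simp add: emeasure_distr * emeasure_eq_measure)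
qed (simp add: sets_uniform_count_measure)

lemma equidistributed_entropy:
  assumes V: "equidistributed V A"
  shows "entropy 2 (count_space (V ` space P)) V = log 2 (card A)"
proof -
  have A: "finite A" "card A > 0"
    using assms sample_nonempty by (auto simp: equidistributed_def card_gt_0_iff)
  have c: "card {\<omega> \<in> \<Omega>. V \<omega> = x} / card \<Omega> = 1 / card A" if "x \<in> A" for x
    using equidistributed_prob[OF V, of "{x}"] that by (simp add: prob_eq)
  \<comment> \<open>The entropy sum ranges over the attained values; every fibre over a point of
    \<open>A\<close> has positive size, so these are all of \<open>A\<close>.\<close>
  have img: "V ` \<Omega> = A"
  proof (rule antisym)
    show "A \<subseteq> V ` \<Omega>"
    proof
      fix x assume "x \<in> A"
      with c[of x] A have "card {\<omega> \<in> \<Omega>. V \<omega> = x} \<noteq> 0" by (metis divide_eq_0_iff of_nat_0 of_nat_eq_0_iff one_neq_zero not_gr_zero)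
      then have "{\<omega> \<in> \<Omega>. V \<omega> = x} \<noteq> {}" by (metis card.empty)
      then show "x \<in> V ` \<Omega>" by auto
    qed
  qed (use V in \<open>simp add: equidistributed_def\<close>)
  have "entropy 2 (count_space (V ` space P)) V = - (\<Sum>x\<in>A. 1 / card A * log 2 (1 / card A))"
    unfolding entropy_simple_distributed[OF simple_distributed_P]
    by (simp add: space_P img c)
  also have "\<dots> = log 2 (card A)"
    using A by (auto simp: log_divide)
  finally show ?thesis .
qed

end

section \<open>Uniform words have independent uniform letters\<close>

lemma card_lists_nth:
  "card {xs. length xs = n \<and> (\<forall>i<n. xs ! i \<in> A i)} = (\<Prod>i<n. card (A i))"
proof (induction n)
  case (Suc n)
  have "{xs. length xs = Suc n \<and> (\<forall>i<Suc n. xs ! i \<in> A i)} =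
    (\<lambda>(xs, x). xs @ [x]) ` ({xs. length xs = n \<and> (\<forall>i<n. xs ! i \<in> A i)} \<times> A n)" (is "?L = ?f ` ?R")
  proof (intro equalityI subsetI)
    fix ys assume ys: "ys \<in> ?L"
    then obtain xs x where "ys = xs @ [x]" by (cases ys rule: rev_cases) auto
    with ys show "ys \<in> ?f ` ?R"
      by (force simp: nth_append less_Suc_eq)
  qed (auto simp: nth_append less_Suc_eq)
  moreover have "inj_on ?f ?R" by (auto simp: inj_on_def)
  ultimately show ?case
    using Suc.IH by (simp add: card_image card_cartesian_product)
qed simp

abbreviation words :: "nat \<Rightarrow> 'b set \<Rightarrow> 'b list set" where
  "words n L \<equiv> {xs. set xs \<subseteq> L \<and> length xs = n}"

lemma words_nth: "words n L = {xs. length xs = n \<and> (\<forall>i<n. xs ! i \<in> L)}"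
  by (auto simp: in_set_conv_nth subset_iff)

context uniform_sample
begin

lemma equidistributed_words:
  assumes V: "equidistributed V (words n L)" and L: "finite L"
    and J: "J \<subseteq> {..<n}" and B: "\<And>i. i \<in> J \<Longrightarrow> B i \<subseteq> L"
  shows "prob {\<omega> \<in> \<Omega>. \<forall>i\<in>J. V \<omega> ! i \<in> B i} = (\<Prod>i\<in>J. card (B i) / card L)"
proof -
  \<comment> \<open>Coordinates outside \<open>J\<close> get the whole alphabet, which turns the
    event into a box whose further factors are 1.\<close>
  define A where "A i = (if i \<in> J then B i else L)" for i
  define T where "T = {xs. length xs = n \<and> (\<forall>i<n. xs ! i \<in> A i)}"
  have AL: "A i \<subseteq> L" for i using B by (auto simp: A_def)
  have T: "T \<subseteq> words n L" using AL unfolding T_def words_nth by blast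
  have "V \<omega> \<in> words n L" if "\<omega> \<in> \<Omega>" for \<omega>
    using V that by (auto simp: equidistributed_def)
  then have "(\<forall>i\<in>J. V \<omega> ! i \<in> B i) \<longleftrightarrow> V \<omega> \<in> T" if "\<omega> \<in> \<Omega>" for \<omega>
    using J that unfolding T_def words_nth A_def by (auto simp: subset_iff)
  then have "{\<omega> \<in> \<Omega>. \<forall>i\<in>J. V \<omega> ! i \<in> B i} = {\<omega> \<in> \<Omega>. V \<omega> \<in> T}"
    by blast
  then have "prob {\<omega> \<in> \<Omega>. \<forall>i\<in>J. V \<omega> ! i \<in> B i} = card T / card (words n L)"
    using equidistributed_prob[OF V T] by simp
  also have "\<dots> = (\<Prod>i<n. card (A i)) / (\<Prod>i<n. card L)"
    unfolding T_def by (simp add: card_lists_nth card_lists_length_eq[OF L])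
  also have "\<dots> = (\<Prod>i<n. card (A i) / card L)"
    by (simp add: prod_dividef)
  also have "\<dots> = (\<Prod>i\<in>J. card (A i) / card L)"
  proof (rule prod.mono_neutral_right)
    \<comment> \<open>Excludes the factor 0 / 0, which is 0 and not 1: over an empty alphabet there
      is no word of positive length, but the sample space is nonempty.\<close>
    have "L \<noteq> {}" if "n > 0"
    proof
      assume "L = {}"
      with that have "words n L = {}" by auto
      then show False using V sample_nonempty by (auto simp: equidistributed_def)
    qed
    then show "\<forall>i\<in>{..<n} - J. card (A i) / card L = 1"
      using L by (auto simp: A_def)
  qed (use J in auto)
  also have "\<dots> = (\<Prod>i\<in>J. card (B i) / card L)" by (simp add: A_def)
  finally show ?thesis .
qed

lemma equidistributed_coordinate:
  assumes V: "equidistributed V (words n L)" and L: "finite L" and i: "i < n"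
  shows "equidistributed (\<lambda>\<omega>. V \<omega> ! i) L"
  unfolding equidistributed_def
proof (intro conjI allI impI)
  show img: "(\<lambda>\<omega>. V \<omega> ! i) ` \<Omega> \<subseteq> L"
    using V i unfolding equidistributed_def words_nth by blast
  fix T assume T: "T \<subseteq> L"
  have "card L > 0" using img sample_nonempty L by (auto simp: card_gt_0_iff)
  moreover have "real (card {\<omega> \<in> \<Omega>. V \<omega> ! i \<in> T}) / card \<Omega> = card T / card L"
    using equidistributed_words[OF V L, of "{i}" "\<lambda>_. T"] i T by (simp add: prob_eq)
  ultimately have "real (card {\<omega> \<in> \<Omega>. V \<omega> ! i \<in> T}) * card L = card T * card \<Omega>"
    using card_sample_pos by (simp add: frac_eq_eq)
  then show "card {\<omega> \<in> \<Omega>. V \<omega> ! i \<in> T} * card L = card T * card \<Omega>"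
    by (simp only: of_nat_eq_iff flip: of_nat_mult)
qed (rule L)

lemma equidistributed_indep_vars:
  assumes V: "equidistributed V (words n L)" and L: "finite L"
  shows "indep_vars (\<lambda>_. count_space L) (\<lambda>i \<omega>. V \<omega> ! i) {..<n}"
  unfolding indep_vars_def2
proof (intro conjI ballI indep_setsI)
  fix i assume i: "i \<in> {..<n}"
  then show "random_variable (count_space L) (\<lambda>\<omega>. V \<omega> ! i)"
    using equidistributed_measurable[OF equidistributed_coordinate[OF V L]] by simp
  then show "{(\<lambda>\<omega>. V \<omega> ! i) -` A \<inter> space P |A. A \<in> sets (count_space L)} \<subseteq> events"
    by (auto intro: measurable_sets)
next
  fix S J assume J: "J \<noteq> {}" "J \<subseteq> {..<n}" "finite J"
    and S: "\<forall>i\<in>J. S i \<in> {(\<lambda>\<omega>. V \<omega> ! i) -` A \<inter> space P |A. A \<in> sets (count_space L)}"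
  have *: "(\<lambda>\<omega>. V \<omega> ! i) -` A \<inter> space P = {\<omega> \<in> \<Omega>. V \<omega> ! i \<in> A}" for i A
    by (auto simp: space_P)
  have "\<forall>i\<in>J. \<exists>A\<subseteq>L. S i = {\<omega> \<in> \<Omega>. V \<omega> ! i \<in> A}"
    using S unfolding * by simp blast
  then obtain B where B: "\<And>i. i \<in> J \<Longrightarrow> B i \<subseteq> L" "\<And>i. i \<in> J \<Longrightarrow> S i = {\<omega> \<in> \<Omega>. V \<omega> ! i \<in> B i}"
    by metis
  have "(\<Inter>i\<in>J. S i) = {\<omega> \<in> \<Omega>. \<forall>i\<in>J. V \<omega> ! i \<in> B i}"
    using J B(2) by auto
  moreover have "prob (S i) = card (B i) / card L" if "i \<in> J" for i
    using equidistributed_words[OF V L, of "{i}" B] J B that by auto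
  ultimately show "prob (\<Inter>i\<in>J. S i) = (\<Prod>i\<in>J. prob (S i))"
    using equidistributed_words[OF V L J(2) B(1)] by simp
qed

end

section \<open>Parity of multicast messages\<close>

text \<open>A fixed-point free involution splits \<open>A\<close> into pairs with equal summands;
  the induction removes one pair at a time.\<close>

lemma even_sum_involution:
  fixes f :: "'a \<Rightarrow> int"
  assumes "finite A"
    and "\<And>a. a \<in> A \<Longrightarrow> g a \<in> A" "\<And>a. a \<in> A \<Longrightarrow> g (g a) = a"
    and "\<And>a. a \<in> A \<Longrightarrow> g a \<noteq> a" "\<And>a. a \<in> A \<Longrightarrow> f (g a) = f a"
  shows "even (sum f A)"
  using assms
proof (induction A rule: finite_psubset_induct)
  case (psubset A)
  show ?case
  proof (cases "A = {}")
    case False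
    then obtain a where a: "a \<in> A" by auto
    define A' where "A' = A - {a, g a}"
    have inv: "g b \<in> A" "g (g b) = b" "g b \<noteq> b" "f (g b) = f b" if "b \<in> A" for b
      using psubset.prems that by blast+
    have "g b \<in> A'" if "b \<in> A'" for b
      using that a inv[of b] inv[of a] unfolding A'_def by (metis Diff_iff insert_iff singletonD)
    then have "even (sum f A')"
      using a by (intro psubset.IH) (auto simp: A'_def inv)
    moreover have "sum f A = f a + (f (g a) + sum f A')"
    proof -
      have "A = insert a (insert (g a) A')" using a inv[OF a] by (auto simp: A'_def)
      then have "sum f A = sum f (insert a (insert (g a) A'))" by simp
      also have "\<dots> = f a + (f (g a) + sum f A')"
        using psubset.hyps inv(3)[OF a] by (simp add: A'_def)
      finally show ?thesis .
    qed
    ultimately show ?thesis using inv(4)[OF a] by simp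
  qed simp
qed

text \<open>The xor sent to the group \<open>B\<close>: each member lacks the piece of its file that
  the others cache. Integers replace bits because only parity matters and differences of two file
  tuples may then be inserted for \<open>x\<close>.\<close>

definition multicast :: "('u \<Rightarrow> 'f) \<Rightarrow> ('f \<Rightarrow> 'u set \<Rightarrow> int) \<Rightarrow> 'u set \<Rightarrow> int" where
  "multicast dem x B = (\<Sum>v\<in>B. x (dem v) (B - {v}))"

text \<open>Two users of \<open>V \<union> {v}\<close> request the file of \<open>v\<close>, and \<open>v\<close> can be exchanged with the other
  one, so every term of the double sum occurs twice.\<close>

lemma even_sum_multicast:
  assumes C: "finite C" and D: "dem ` C \<subseteq> D"
  shows "even (\<Sum>V | V \<subseteq> C \<and> bij_betw dem V D. multicast dem x (C - V))"
proof -
  let ?\<V> = "{V. V \<subseteq> C \<and> bij_betw dem V D}"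
  let ?S = "Sigma ?\<V> (\<lambda>V. C - V)"
  define w where "w V v = the_inv_into V dem (dem v)" for V v
  define g where "g = (\<lambda>(V, v). (insert v (V - {w V v}), w V v))"
  have w: "w V v \<in> V" "dem (w V v) = dem v" if "(V, v) \<in> ?S" for V v
  proof -
    have "inj_on dem V" "dem v \<in> dem ` V" using that D by (auto simp: bij_betw_def)
    then show "w V v \<in> V" "dem (w V v) = dem v"
      unfolding w_def by (auto intro: the_inv_into_into f_the_inv_into_f)
  qed
  have w_eq: "w V v = u" if "bij_betw dem V D" "u \<in> V" "dem u = dem v" for V v u
    unfolding w_def by (metis bij_betw_imp_inj_on that the_inv_into_f_f)
  have bij: "bij_betw dem (insert v (V - {w V v})) D" if "(V, v) \<in> ?S" for V v
  proof -
    have "bij_betw dem V D" "v \<notin> V" using that by auto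
    with w[OF that] show ?thesis
      unfolding bij_betw_def inj_on_def by (auto simp: image_iff) metis+
  qed
  have finite_S: "finite ?S" using C by auto
  have "even (\<Sum>p\<in>?S. (\<lambda>(V, v). x (dem v) (C - V - {v})) p)"
  proof (rule even_sum_involution[OF finite_S, where g = g])
    fix p assume p: "p \<in> ?S"
    obtain V v where pv: "p = (V, v)" by (cases p)
    with p have Vv: "(V, v) \<in> ?S" by simp
    then have V: "V \<subseteq> C" "bij_betw dem V D" "v \<in> C" "v \<notin> V" by auto
    note w = w[OF Vv] and bij = bij[OF Vv]
    have ne: "w V v \<noteq> v" using w V by auto
    show "g p \<in> ?S" using w V bij ne by (auto simp: pv g_def)
    have "w (insert v (V - {w V v})) (w V v) = v"
      using bij w by (intro w_eq) auto
    then show "g (g p) = p" using w V ne by (auto simp: pv g_def)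
    show "g p \<noteq> p" using ne by (simp add: pv g_def)
    \<comment> \<open>The piece is labelled by a set that omits both \<open>v\<close> and its
      partner, so the exchange does not change it.\<close>
    have "C - insert v (V - {w V v}) - {w V v} = C - V - {v}" using w V by auto
    then show "(\<lambda>(V, v). x (dem v) (C - V - {v})) (g p) = (\<lambda>(V, v). x (dem v) (C - V - {v})) p"
      using w by (simp add: pv g_def)
  qed
  moreover have "(\<Sum>V\<in>?\<V>. multicast dem x (C - V)) = (\<Sum>p\<in>?S. (\<lambda>(V, v). x (dem v) (C - V - {v})) p)"
    unfolding multicast_def using C by (subst sum.Sigma) auto
  ultimately show ?thesis by simp
qed

text \<open>With \<open>C = B \<union> U\<close>, the messages of \<open>C - V\<close> add up to an
  even number over all \<open>V\<close> that request each file once. The choice \<open>V = U\<close>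
  gives \<open>B\<close> itself; any other \<open>V\<close> has the same size and misses a leader,
  so that \<open>C - V\<close> is covered by \<open>lead\<close>. Thus the message of
  \<open>B\<close> is redundant.\<close>

lemma even_multicast_without_leaders:
  assumes A: "finite A" "U \<subseteq> A" "bij_betw dem U D" "dem ` A \<subseteq> D"
    and lead: "\<And>B. B \<subseteq> A \<Longrightarrow> card B = k \<Longrightarrow> B \<inter> U \<noteq> {} \<Longrightarrow> even (multicast dem x B)"
    and B: "B \<subseteq> A" "card B = k"
  shows "even (multicast dem x B)"
proof (cases "B \<inter> U = {}")
  case False
  then show ?thesis using lead B by simp
next
  case True
  define C where "C = B \<union> U"
  let ?\<V> = "{V. V \<subseteq> C \<and> bij_betw dem V D}"
  have C: "finite C" "C \<subseteq> A" using A B by (auto simp: C_def intro: finite_subset)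
  have finU: "finite U" using A finite_subset by blast
  have CU: "C - U = B" using True by (auto simp: C_def)
  have "even (multicast dem x (C - V))" if V: "V \<in> ?\<V> - {U}" for V
  proof (rule lead)
    have finV: "finite V" using V C finite_subset by blast
    have cV: "card V = card U" using V A by (metis (no_types, lifting) DiffD1 bij_betw_same_card mem_Collect_eq)
    show "C - V \<subseteq> A" using C by auto
    have "card (C - V) = card C - card V" using V finV by (intro card_Diff_subset) auto
    also have "\<dots> = card (C - U)" unfolding cV
      using finU by (intro card_Diff_subset[symmetric]) (auto simp: C_def)
    finally show "card (C - V) = k" using CU B by simp
    show "(C - V) \<inter> U \<noteq> {}"
    proof
      assume "(C - V) \<inter> U = {}"
      then have "U \<subseteq> V" by (auto simp: C_def)
      then have "U = V" using finV cV by (metis card_subset_eq)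
      then show False using V by simp
    qed
  qed
  then have "even (\<Sum>V\<in>?\<V> - {U}. multicast dem x (C - V))"
    by (intro dvd_sum) blast
  moreover have "(\<Sum>V\<in>?\<V>. multicast dem x (C - V)) =
      multicast dem x (C - U) + (\<Sum>V\<in>?\<V> - {U}. multicast dem x (C - V))"
    using C A by (intro sum.remove) (auto simp: C_def)
  moreover have "even (\<Sum>V\<in>?\<V>. multicast dem x (C - V))"
    using C A by (intro even_sum_multicast) auto
  ultimately show ?thesis by (simp add: CU)
qed

text \<open>In the message for \<open>insert u T\<close>, every summand other than that of
  \<open>u\<close> is a piece whose label contains \<open>u\<close>, hence is cached and contributes
  0.\<close>

lemma even_multicast_decode:
  assumes A: "finite A" "U \<subseteq> A" "bij_betw dem U D" "dem ` A \<subseteq> D"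
    and lead: "\<And>B. B \<subseteq> A \<Longrightarrow> card B = Suc t \<Longrightarrow> B \<inter> U \<noteq> {} \<Longrightarrow> even (multicast dem x B)"
    and u: "u \<in> A" and cached: "\<And>i T. i \<in> D \<Longrightarrow> T \<subseteq> A \<Longrightarrow> card T = t \<Longrightarrow> u \<in> T \<Longrightarrow> x i T = 0"
    and T: "T \<subseteq> A" "card T = t"
  shows "even (x (dem u) T)"
proof (cases "u \<in> T")
  case True
  then show ?thesis using cached[of "dem u" T] T u A by auto
next
  case False
  have finT: "finite T" using A T finite_subset by blast
  have "even (multicast dem x (insert u T))"
    using False T u finT by (intro even_multicast_without_leaders[OF A lead]) auto
  moreover have "multicast dem x (insert u T) = x (dem u) T + (\<Sum>v\<in>T. x (dem v) (insert u T - {v}))"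
    using False finT by (simp add: multicast_def)
  moreover have "(\<Sum>v\<in>T. x (dem v) (insert u T - {v})) = 0"
  proof (rule sum.neutral, rule ballI, rule cached)
    fix v assume v: "v \<in> T"
    show "dem v \<in> D" using v T A by auto
    show "insert u T - {v} \<subseteq> A" using T u by auto
    show "card (insert u T - {v}) = t" using v T False finT by (simp add: card_Diff_singleton_if)
    show "u \<in> insert u T - {v}" using v False by auto
  qed
  ultimately show ?thesis by simp
qed

text \<open>Complementary counting; with \<open>k = t + 1\<close> and the N leaders as
  \<open>U\<close> this is the numerator of the load.\<close>

lemma card_subsets_meeting:
  assumes "finite A" "U \<subseteq> A"
  shows "real (card {T. T \<subseteq> A \<and> card T = k \<and> T \<inter> U \<noteq> {}}) =
    real (card A choose k) - real ((card A - card U) choose k)"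
proof -
  let ?M = "{T. T \<subseteq> A \<and> card T = k \<and> T \<inter> U \<noteq> {}}" and ?N = "{T. T \<subseteq> A - U \<and> card T = k}"
  have "{T. T \<subseteq> A \<and> card T = k} = ?M \<union> ?N" by auto
  moreover have "card (?M \<union> ?N) = card ?M + card ?N"
    using assms by (intro card_Un_disjoint) (auto intro: finite_subset[of _ "Pow A"])
  ultimately have "card A choose k = card ?M + card ?N"
    using n_subsets[OF assms(1)] by metis
  moreover have "card ?N = (card A - card U) choose k"
    using assms n_subsets[of "A - U" k] by (simp add: card_Diff_subset finite_subset)
  ultimately show ?thesis by simp
qed

text \<open>Each element lies in the fraction \<open>k / card A\<close> of the subsets of size
  \<open>k\<close>. For N * K virtual users and N files this becomes the memory
  \<open>t / K\<close>.\<close>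

lemma card_subsets_containing:
  assumes "finite A" "v \<in> A"
  shows "real (card A) * card {T. T \<subseteq> A \<and> card T = k \<and> v \<in> T} = k * (card A choose k)"
proof -
  have "real (card {T. T \<subseteq> A \<and> card T = k \<and> v \<in> T}) = real (card A choose k) - real ((card A - 1) choose k)"
    using card_subsets_meeting[of A "{v}" k] assms by simp
  moreover have "(real (card A) - k) * (card A choose k) = card A * ((card A - 1) choose k)"
  proof (cases "k \<le> card A")
    case True
    then show ?thesis
      using binomial_absorb_comp[of "card A" k] by (simp flip: of_nat_mult of_nat_diff)
  qed (simp add: binomial_eq_0)
  ultimately have "real (card A) * card {T. T \<subseteq> A \<and> card T = k \<and> v \<in> T} =
      card A * real (card A choose k) - (real (card A) - k) * (card A choose k)"
    by (simp add: right_diff_distrib)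
  then show ?thesis by (simp add: left_diff_distrib)
qed

section \<open>The virtual user scheme\<close>

text \<open>The solution \<open>c\<close> of \<open>a + b + c = 0\<close> modulo \<open>N\<close>: any two of demand, key and shift determine
  the remaining one by the same rule.\<close>

definition third :: "nat \<Rightarrow> nat \<Rightarrow> nat \<Rightarrow> nat" where
  "third N a b = (2 * N - a - b) mod N"

lemma third_less: "0 < N \<Longrightarrow> third N a b < N"
  by (simp add: third_def)

lemma third_commute: "third N a b = third N b a"
  by (simp add: third_def add.commute)

lemma third_third:
  assumes "a < N" "b < N"
  shows "third N a (third N a b) = b"
proof -
  \<comment> \<open>As \<open>a + b < 2 * N\<close>, the natural subtraction does not truncate. The
    three cases are those in which \<open>mod\<close> removes N twice, once or not at all.\<close>
  have eq: "third N a b = (if a + b = 0 then 0 else if a + b \<le> N then N - (a + b) else 2 * N - (a + b))"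
    if "b < N" for b
    using assms(1) that by (auto simp: third_def mod_if)
  have "third N a b < N" using assms by (simp add: third_less)
  then show ?thesis
    using assms by (auto simp: eq split: if_splits)
qed

text \<open>Caches and messages have to be bit strings, while the scheme produces tuples of sets.
  Entropy only sees which values are distinguished, so any injection serves, whatever the lengths of
  its code words.\<close>

definition code :: "'b set \<Rightarrow> 'b \<Rightarrow> bool list" where
  "code S = (SOME f. inj_on f S)"

lemma inj_on_code:
  fixes S :: "'b set"
  assumes "finite S"
  shows "inj_on (code S) S"
proof -
  from assms obtain g :: "'b \<Rightarrow> nat" where "inj_on g S" using finite_imp_inj_to_nat_seg by blast
  then have "inj_on (\<lambda>x. replicate (g x) True) S" by (auto simp: inj_on_def)
  then show ?thesis unfolding code_def by (rule someI[where P = "\<lambda>f. inj_on f S"])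
qed

lemma code_eq_iff: "finite S \<Longrightarrow> x \<in> S \<Longrightarrow> y \<in> S \<Longrightarrow> code S x = code S y \<longleftrightarrow> x = y"
  by (meson inj_on_code inj_on_eq_iff)

text \<open>User \<open>k\<close> acts as the virtual user \<open>k * N + s\<close> for a secret uniform \<open>s < N\<close>, and the virtual
  user \<open>v\<close> requests the file \<open>third N q (v mod N)\<close> for a public \<open>q\<close> of its stack \<open>v div N\<close>. Each
  triple \<open>(t, j, T)\<close> in \<open>labels\<close> names the bit at position \<open>pos (t, j, T)\<close> of every file; it is cached
  by the virtual users in \<open>T\<close>. The virtual users of stack \<open>0\<close> are the leaders.\<close>

locale virtual_user_scheme =
  fixes N K F :: nat and m :: "nat \<Rightarrow> nat" and pos :: "nat \<times> nat \<times> nat set \<Rightarrow> nat"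
  assumes N_pos: "0 < N" and K_pos: "0 < K"
begin

section \<open>Labels, transmitted groups and their numbers\<close>

definition labels :: "(nat \<times> nat \<times> nat set) set" where
  "labels = (SIGMA t:{..N * K}. {..<m t} \<times> {T. T \<subseteq> {..<N * K} \<and> card T = t})"

definition messages :: "(nat \<times> nat \<times> nat set) set" where
  "messages = (SIGMA t:{..N * K}. {..<m t} \<times>
     {B. B \<subseteq> {..<N * K} \<and> card B = t + 1 \<and> B \<inter> {..<N} \<noteq> {}})"

definition cached_labels :: "nat \<Rightarrow> (nat \<times> nat \<times> nat set) set" where
  "cached_labels v = (SIGMA t:{..N * K}. {..<m t} \<times> {T. T \<subseteq> {..<N * K} \<and> card T = t \<and> v \<in> T})"

lemma finite_labels: "finite labels"
  unfolding labels_def by (auto intro: finite_subset[of _ "Pow {..<N * K}"])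

lemma finite_messages: "finite messages"
  unfolding messages_def by (auto intro: finite_subset[of _ "Pow {..<N * K}"])

lemma card_labels: "card labels = (\<Sum>t\<le>N * K. m t * (N * K choose t))"
  unfolding labels_def by (subst card_SigmaI) (auto simp: card_cartesian_product n_subsets)

lemma card_messages:
  "real (card messages) = (\<Sum>t\<le>N * K. m t * (real (N * K choose (t + 1)) - real ((N * K - N) choose (t + 1))))"
proof -
  have "{..<N} \<subseteq> {..<N * K}" using K_pos by (auto intro: less_le_trans)
  then show ?thesis
    using card_subsets_meeting[of "{..<N * K}" "{..<N}"]
    unfolding messages_def by (subst card_SigmaI) (auto simp: card_cartesian_product)
qed

lemma card_cached_labels:
  assumes "v < N * K"
  shows "real N * card (cached_labels v) = (\<Sum>t\<le>N * K. m t * (real t / K * (N * K choose t)))"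
proof -
  have "real N * card {T. T \<subseteq> {..<N * K} \<and> card T = t \<and> v \<in> T} = real t / K * (N * K choose t)" for t
    using card_subsets_containing[of "{..<N * K}" v t] assms K_pos by (simp add: field_simps)
  note this[symmetric]
  then show ?thesis
    unfolding cached_labels_def
    by (subst card_SigmaI) (auto simp: card_cartesian_product sum_distrib_left intro!: sum.cong)
qed

definition uncoded :: "nat set" where
  "uncoded = {..<F} - pos ` labels"

definition demand :: "nat list \<Rightarrow> nat \<Rightarrow> nat" where
  "demand q v = third N (q ! (v div N)) (v mod N)"

definition coded :: "bool list list \<Rightarrow> nat list \<Rightarrow> nat \<times> nat \<times> nat set \<Rightarrow> int" where
  "coded fs q = (\<lambda>(t, j, B). multicast (demand q) (\<lambda>i T. of_bool (fs ! i ! pos (t, j, T))) B)"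

text \<open>The cached bits are encoded by the set of positions holding ones. The key is included
  because the metadata must be recoverable from the cache.\<close>

definition cache_data :: "nat \<Rightarrow> nat \<Rightarrow> bool list list \<Rightarrow> nat \<times> (nat \<times> nat) set" where
  "cache_data k s fs = (s, {(i, p). i < N \<and> p \<in> pos ` cached_labels (k * N + s) \<and> fs ! i ! p})"

text \<open>The shifts \<open>q\<close> are sent along so that every user knows all virtual
  requests, and thus how to resolve the multicasts.\<close>

definition broadcast_data :: "nat list \<Rightarrow> bool list list \<Rightarrow> nat list \<times> (nat \<times> nat \<times> nat set) set \<times> (nat \<times> nat) set" where
  "broadcast_data q fs = (q, {b \<in> messages. odd (coded fs q b)}, {(i, p). i < N \<and> p \<in> uncoded \<and> fs ! i ! p})"

definition cache_values :: "nat \<Rightarrow> (nat \<times> (nat \<times> nat) set) set" where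
  "cache_values k = (SIGMA s:{..<N}. Pow ({..<N} \<times> pos ` cached_labels (k * N + s)))"

definition broadcast_values :: "(nat list \<times> (nat \<times> nat \<times> nat set) set \<times> (nat \<times> nat) set) set" where
  "broadcast_values = words K {..<N} \<times> Pow messages \<times> Pow ({..<N} \<times> uncoded)"

lemma finite_cached_labels: "finite (cached_labels v)"
  using finite_labels by (rule rev_finite_subset) (auto simp: cached_labels_def labels_def)

lemma finite_cache_values: "finite (cache_values k)"
  unfolding cache_values_def using finite_cached_labels by auto

lemma finite_broadcast_values: "finite broadcast_values"
  unfolding broadcast_values_def using finite_messages
  by (auto simp: uncoded_def intro: finite_lists_length_eq)

lemma card_broadcast_values:
  "card broadcast_values = N ^ K * 2 ^ (card messages + N * card uncoded)"
  unfolding broadcast_values_def using finite_messages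
  by (simp add: card_cartesian_product card_lists_length_eq card_Pow uncoded_def power_add)

lemma cache_data_in: "s < N \<Longrightarrow> cache_data k s fs \<in> cache_values k"
  by (auto simp: cache_data_def cache_values_def)

lemma broadcast_data_in: "q \<in> words K {..<N} \<Longrightarrow> broadcast_data q fs \<in> broadcast_values"
  by (auto simp: broadcast_data_def broadcast_values_def)

text \<open>The key of user \<open>k\<close> is the length of its metadata string. The shift solves
  \<open>demand + key + shift = 0\<close> modulo N, so that the virtual user selected by the key
  requests the actual demand.\<close>

definition public :: "nat list \<Rightarrow> bool list list \<Rightarrow> nat list" where
  "public ds ms = map (\<lambda>k. third N (ds ! k) (length (ms ! k))) [0..<K]"

lemma public_in: "public ds ms \<in> words K {..<N}"
  using N_pos by (auto simp: public_def third_less)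

definition scheme_cache :: "nat \<Rightarrow> bool list list \<Rightarrow> bool list \<Rightarrow> bool list" where
  "scheme_cache k fs mk = code (cache_values k) (cache_data k (length mk) fs)"

definition scheme_broadcast :: "nat list \<Rightarrow> bool list list \<Rightarrow> bool list list \<Rightarrow> bool list" where
  "scheme_broadcast ds fs ms = code broadcast_values (broadcast_data (public ds ms) fs)"

definition keys :: "bool list set" where
  "keys = (\<lambda>s. replicate s True) ` {..<N}"

definition sample :: "outcome set" where
  "sample = words N {w. length w = F} \<times> words K keys \<times> words K {..<N}"

lemma keys: "finite keys" "card keys = N" "w \<in> keys \<Longrightarrow> length w < N \<and> replicate (length w) True = w"
proof -
  have "inj_on (\<lambda>s. replicate s True) {..<N}" by (rule inj_onI) (metis length_replicate)
  then show "card keys = N" by (simp add: keys_def card_image)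
qed (auto simp: keys_def)

lemma replicate_in_keys: "s < N \<Longrightarrow> replicate s True \<in> keys"
  by (simp add: keys_def)

lemma file_words: "finite {w :: bool list. length w = F}" "card {w :: bool list. length w = F} = 2 ^ F"
  using finite_lists_length_eq[of "UNIV :: bool set" F] card_lists_length_eq[of "UNIV :: bool set" F]
  by simp_all

lemma card_sample: "card sample = (2 ^ F) ^ N * (N ^ K * N ^ K)"
  unfolding sample_def
  by (simp only: card_cartesian_product card_lists_length_eq[OF file_words(1)] file_words(2)
      card_lists_length_eq[OF keys(1)] keys(2) card_lists_length_eq[OF finite_lessThan] card_lessThan)

sublocale sample: uniform_sample sample
proof
  have "card sample > 0" using N_pos by (simp add: card_sample)
  then show "finite sample" "sample \<noteq> {}" by (auto simp: card_gt_0_iff)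
qed

lemma third_simps:
  "a < N \<Longrightarrow> b < N \<Longrightarrow> third N a (third N a b) = b"
  "a < N \<Longrightarrow> b < N \<Longrightarrow> third N a (third N b a) = b"
  "a < N \<Longrightarrow> b < N \<Longrightarrow> third N (third N a b) a = b"
  "a < N \<Longrightarrow> b < N \<Longrightarrow> third N (third N b a) a = b"
  "third N a b < N"
  using third_third third_commute third_less N_pos by metis+

section \<open>Decodability\<close>

lemma demand_less: "demand q v < N"
  by (simp add: demand_def third_simps)

lemma demand_leaders:
  assumes "q ! 0 < N"
  shows "bij_betw (demand q) {..<N} {..<N}"
  by (rule bij_betw_byWitness[where f' = "third N (q ! 0)"])
     (use assms in \<open>auto simp: demand_def third_simps\<close>)

text \<open>Multicast sums are linear in the files, so the parity lemmas apply to the difference of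
  two file tuples: its transmitted messages are even and its cached pieces vanish. This avoids
  constructing a decoder.\<close>

lemma decoding:
  assumes k: "k < K" and s: "s < N" and q: "q \<in> words K {..<N}"
    and fs: "fs \<in> words N {w. length w = F}" "fs' \<in> words N {w. length w = F}"
    and cache: "cache_data k s fs = cache_data k s fs'"
    and broadcast: "broadcast_data q fs = broadcast_data q fs'"
  shows "fs ! third N (q ! k) s = fs' ! third N (q ! k) s"
proof -
  define i where "i = third N (q ! k) s"
  define u where "u = k * N + s"
  have i: "i < N" by (simp add: i_def third_simps)
  have "u < (k + 1) * N" using s by (simp add: u_def)
  also have "\<dots> \<le> N * K" using k by (metis Suc_eq_plus1 Suc_leI mult.commute mult_le_mono1)
  finally have u: "u < N * K" .
  have demand_u: "demand q u = i" using s by (simp add: demand_def u_def i_def)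
  have len: "length (fs ! i) = F" "length (fs' ! i) = F" using fs i by (auto simp: words_nth)
  have cached_eq: "fs ! i' ! p = fs' ! i' ! p" if "i' < N" "p \<in> pos ` cached_labels u" for i' p
    using cache that unfolding cache_data_def u_def by (auto simp: set_eq_iff)
  have uncoded_eq: "fs ! i' ! p = fs' ! i' ! p" if "i' < N" "p \<in> uncoded" for i' p
    using broadcast that unfolding broadcast_data_def by (auto simp: set_eq_iff)
  have coded_eq: "odd (coded fs q b) \<longleftrightarrow> odd (coded fs' q b)" if "b \<in> messages" for b
    using broadcast that unfolding broadcast_data_def by blast
  have "fs ! i ! p = fs' ! i ! p" if p: "p < F" for p
  proof (cases "p \<in> uncoded")
    case False
    with p obtain t j T where p_eq: "p = pos (t, j, T)"
      and T: "t \<le> N * K" "j < m t" "T \<subseteq> {..<N * K}" "card T = t"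
      by (auto simp: uncoded_def labels_def)
    define x where "x i' T' = of_bool (fs ! i' ! pos (t, j, T')) - (of_bool (fs' ! i' ! pos (t, j, T')) :: int)"
      for i' T'
    have "even (x (demand q u) T)"
    proof (rule even_multicast_decode[where x = x and dem = "demand q" and u = u and T = T and A = "{..<N * K}" and U = "{..<N}" and D = "{..<N}" and t = t])
      show "{..<N} \<subseteq> {..<N * K}" using K_pos by (auto intro: less_le_trans)
      show "bij_betw (demand q) {..<N} {..<N}" using q K_pos by (intro demand_leaders) (auto simp: words_nth)
      show "even (multicast (demand q) x B)"
        if "B \<subseteq> {..<N * K}" "card B = Suc t" "B \<inter> {..<N} \<noteq> {}" for B
      proof -
        have "(t, j, B) \<in> messages" using that T by (auto simp: messages_def)
        moreover have "multicast (demand q) x B = coded fs q (t, j, B) - coded fs' q (t, j, B)"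
          by (simp add: multicast_def coded_def x_def sum_subtractf)
        ultimately show ?thesis using coded_eq by simp
      qed
      show "x i' T' = 0" if "i' \<in> {..<N}" "T' \<subseteq> {..<N * K}" "card T' = t" "u \<in> T'" for i' T'
      proof -
        have "(t, j, T') \<in> cached_labels u" using that T by (auto simp: cached_labels_def)
        then show ?thesis using cached_eq[of i'] that by (simp add: x_def)
      qed
    qed (use u T demand_less in auto)
    \<comment> \<open>A difference of two bits that is even is 0.\<close>
    then show ?thesis by (auto simp: x_def demand_u p_eq of_bool_def split: if_splits)
  qed (use uncoded_eq i in auto)
  then show ?thesis using len unfolding i_def by (intro nth_equalityI) auto
qed

section \<open>The random variables of the scheme\<close>

abbreviation file_at :: "nat \<Rightarrow> outcome \<Rightarrow> bool list" where
  "file_at i \<omega> \<equiv> fst \<omega> ! i"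

abbreviation key_at :: "nat \<Rightarrow> outcome \<Rightarrow> bool list" where
  "key_at k \<omega> \<equiv> fst (snd \<omega>) ! k"

abbreviation request_at :: "nat \<Rightarrow> outcome \<Rightarrow> nat" where
  "request_at k \<omega> \<equiv> snd (snd \<omega>) ! k"

abbreviation shifts :: "outcome \<Rightarrow> nat list" where
  "shifts \<omega> \<equiv> public (snd (snd \<omega>)) (fst (snd \<omega>))"

lemma tuple_sample:
  assumes "\<omega> \<in> sample"
  shows "tuple N file_at \<omega> = fst \<omega>" "tuple K key_at \<omega> = fst (snd \<omega>)" "tuple K request_at \<omega> = snd (snd \<omega>)"
  using assms by (auto simp: sample_def tuple_def intro!: nth_equalityI)

lemma sample_simps:
  assumes "\<omega> \<in> sample"
  shows "fst \<omega> \<in> words N {w. length w = F}" "length (fst (snd \<omega>)) = K" "length (snd (snd \<omega>)) = K"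
    and "k < K \<Longrightarrow> length (key_at k \<omega>) < N" "k < K \<Longrightarrow> replicate (length (key_at k \<omega>)) True = key_at k \<omega>"
    and "k < K \<Longrightarrow> request_at k \<omega> < N"
  using assms keys(3)[of "key_at k \<omega>"] unfolding sample_def words_nth by auto

text \<open>The sample space is a product of word sets, so preimages under its projections are boxes
  and their cardinalities factor.\<close>

lemma equidistributed_file: "sample.equidistributed (tuple N file_at) (words N {w. length w = F})"
  and equidistributed_key: "sample.equidistributed (tuple K key_at) (words K keys)"
  and equidistributed_request: "sample.equidistributed (tuple K request_at) (words K {..<N})"
  and equidistributed_joint:
    "sample.equidistributed (\<lambda>\<omega>. (tuple N file_at \<omega>, tuple K key_at \<omega>, tuple K request_at \<omega>)) sample"
proof -
  let ?A = "words N {w :: bool list. length w = F}" and ?B = "words K keys" and ?C = "words K {..<N}"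
  note t = tuple_sample
  have f: "finite ?A" "finite ?B" "finite ?C"
    using file_words(1) keys(1) by (auto intro!: finite_lists_length_eq)
  have card_sample_eq: "card sample = card ?A * (card ?B * card ?C)"
    by (simp only: sample_def card_cartesian_product)
  have A: "{\<omega> \<in> sample. tuple N file_at \<omega> \<in> T} = T \<times> ?B \<times> ?C" if "T \<subseteq> ?A" for T
    using that t(1) by (auto simp: sample_def)
  show "sample.equidistributed (tuple N file_at) ?A"
    unfolding sample.equidistributed_def
  proof (intro conjI allI impI)
    show "tuple N file_at ` sample \<subseteq> ?A" using t(1) by (auto simp: sample_def)
  qed (simp_all only: f A card_sample_eq card_cartesian_product mult_ac)
  have B: "{\<omega> \<in> sample. tuple K key_at \<omega> \<in> T} = ?A \<times> T \<times> ?C" if "T \<subseteq> ?B" for T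
    using that t(2) by (auto simp: sample_def)
  show "sample.equidistributed (tuple K key_at) ?B"
    unfolding sample.equidistributed_def
  proof (intro conjI allI impI)
    show "tuple K key_at ` sample \<subseteq> ?B" using t(2) by (auto simp: sample_def)
  qed (simp_all only: f B card_sample_eq card_cartesian_product mult_ac)
  have C: "{\<omega> \<in> sample. tuple K request_at \<omega> \<in> T} = ?A \<times> ?B \<times> T" if "T \<subseteq> ?C" for T
    using that t(3) by (auto simp: sample_def)
  show "sample.equidistributed (tuple K request_at) ?C"
    unfolding sample.equidistributed_def
  proof (intro conjI allI impI)
    show "tuple K request_at ` sample \<subseteq> ?C" using t(3) by (auto simp: sample_def)
  qed (simp_all only: f C card_sample_eq card_cartesian_product mult_ac)
  have D: "{\<omega> \<in> sample. (tuple N file_at \<omega>, tuple K key_at \<omega>, tuple K request_at \<omega>) \<in> T} = T" if "T \<subseteq> sample" for T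
    using that t by auto
  show "sample.equidistributed (\<lambda>\<omega>. (tuple N file_at \<omega>, tuple K key_at \<omega>, tuple K request_at \<omega>)) sample"
    unfolding sample.equidistributed_def
    using sample.finite_sample t by (auto simp: D)
qed

lemma shifts_nth: "k < K \<Longrightarrow> shifts \<omega> ! k = third N (request_at k \<omega>) (length (key_at k \<omega>))"
  by (simp add: public_def)

definition cache_at :: "nat \<Rightarrow> outcome \<Rightarrow> bool list" where
  "cache_at k \<omega> = scheme_cache k (tuple N file_at \<omega>) (key_at k \<omega>)"

definition broadcast_at :: "outcome \<Rightarrow> bool list" where
  "broadcast_at \<omega> = scheme_broadcast (tuple K request_at \<omega>) (tuple N file_at \<omega>) (tuple K key_at \<omega>)"

lemma cache_at_eq:
  "\<omega> \<in> sample \<Longrightarrow> cache_at k \<omega> = code (cache_values k) (cache_data k (length (key_at k \<omega>)) (fst \<omega>))"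
  by (simp add: cache_at_def scheme_cache_def tuple_sample)

lemma broadcast_at_eq:
  "\<omega> \<in> sample \<Longrightarrow> broadcast_at \<omega> = code broadcast_values (broadcast_data (shifts \<omega>) (fst \<omega>))"
  by (simp add: broadcast_at_def scheme_broadcast_def tuple_sample)

lemma cache_at_eq_iff:
  assumes "\<omega> \<in> sample" "\<omega>' \<in> sample" "k < K"
  shows "cache_at k \<omega> = cache_at k \<omega>' \<longleftrightarrow>
    cache_data k (length (key_at k \<omega>)) (fst \<omega>) = cache_data k (length (key_at k \<omega>')) (fst \<omega>')"
  using assms by (simp add: cache_at_eq code_eq_iff finite_cache_values cache_data_in sample_simps)

lemma broadcast_at_eq_iff:
  assumes "\<omega> \<in> sample" "\<omega>' \<in> sample"
  shows "broadcast_at \<omega> = broadcast_at \<omega>' \<longleftrightarrow>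
    broadcast_data (shifts \<omega>) (fst \<omega>) = broadcast_data (shifts \<omega>') (fst \<omega>')"
  using assms code_eq_iff[OF finite_broadcast_values broadcast_data_in[OF public_in] broadcast_data_in[OF public_in]]
  by (simp add: broadcast_at_eq)

lemma cache_at_key_length:
  assumes "\<omega> \<in> sample" "\<omega>' \<in> sample" "k < K" "cache_at k \<omega> = cache_at k \<omega>'"
  shows "length (key_at k \<omega>) = length (key_at k \<omega>')"
  using assms by (simp add: cache_at_eq_iff cache_data_def)

text \<open>Equal broadcasts have equal shifts and equal caches have equal keys; key and shift give
  the demand by \<open>third\<close>, which reduces the claim to \<open>decoding\<close> for one
  virtual user.\<close>

lemma file_determined:
  assumes \<omega>: "\<omega> \<in> sample" "\<omega>' \<in> sample" and k: "k < K"
    and eq: "request_at k \<omega> = request_at k \<omega>'" "cache_at k \<omega> = cache_at k \<omega>'" "broadcast_at \<omega> = broadcast_at \<omega>'"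
  shows "file_at (request_at k \<omega>) \<omega> = file_at (request_at k \<omega>') \<omega>'"
proof -
  have "broadcast_data (shifts \<omega>) (fst \<omega>) = broadcast_data (shifts \<omega>') (fst \<omega>')"
    using \<omega> eq(3) by (simp add: broadcast_at_eq_iff)
  moreover from this have "shifts \<omega> = shifts \<omega>'" by (simp add: broadcast_data_def)
  moreover have "length (key_at k \<omega>) = length (key_at k \<omega>')"
    using cache_at_key_length[OF \<omega> k eq(2)] .
  ultimately have "fst \<omega> ! third N (shifts \<omega> ! k) (length (key_at k \<omega>)) =
      fst \<omega>' ! third N (shifts \<omega> ! k) (length (key_at k \<omega>))"
    using \<omega> k eq(2) by (intro decoding public_in sample_simps(1)) (simp_all add: sample_simps(4) cache_at_eq_iff)
  moreover have "third N (shifts \<omega> ! k) (length (key_at k \<omega>)) = request_at k \<omega>"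
    using k \<omega>(1) unfolding shifts_nth[OF k] by (simp add: third_simps sample_simps)
  ultimately show ?thesis using eq(1) by simp
qed

text \<open>Both swaps take files and shifts, hence the broadcast, from \<open>\<omega>'\<close>; the first keeps the demands
  of \<open>\<omega>\<close>, the second its keys.\<close>

definition swap_keys :: "outcome \<Rightarrow> outcome \<Rightarrow> outcome" where
  "swap_keys \<omega> \<omega>' = (fst \<omega>',
     map (\<lambda>k. replicate (third N (shifts \<omega>' ! k) (request_at k \<omega>)) True) [0..<K], snd (snd \<omega>))"

definition swap_requests :: "outcome \<Rightarrow> outcome \<Rightarrow> outcome" where
  "swap_requests \<omega> \<omega>' = (fst \<omega>', fst (snd \<omega>),
     map (\<lambda>k. third N (shifts \<omega>' ! k) (length (key_at k \<omega>))) [0..<K])"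

lemma swap_in_sample:
  assumes "\<omega> \<in> sample" "\<omega>' \<in> sample"
  shows "swap_keys \<omega> \<omega>' \<in> sample" "swap_requests \<omega> \<omega>' \<in> sample"
proof -
  have "map (\<lambda>k. replicate (third N (shifts \<omega>' ! k) (request_at k \<omega>)) True) [0..<K] \<in> words K keys"
    "map (\<lambda>k. third N (shifts \<omega>' ! k) (length (key_at k \<omega>))) [0..<K] \<in> words K {..<N}"
    by (auto simp: third_simps intro!: replicate_in_keys)
  then show "swap_keys \<omega> \<omega>' \<in> sample" "swap_requests \<omega> \<omega>' \<in> sample"
    using assms by (simp_all only: sample_def swap_keys_def swap_requests_def mem_Times_iff fst_conv snd_conv)
qed

lemma shifts_less: "k < K \<Longrightarrow> shifts \<omega> ! k < N"
  by (simp add: shifts_nth third_simps)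

lemma shifts_length: "length (shifts \<omega>) = K"
  by (simp add: public_def)

lemma shifts_swap:
  assumes "\<omega> \<in> sample" "\<omega>' \<in> sample"
  shows "shifts (swap_keys \<omega> \<omega>') = shifts \<omega>'" "shifts (swap_requests \<omega> \<omega>') = shifts \<omega>'"
proof -
  have "shifts (swap_keys \<omega> \<omega>') ! k = shifts \<omega>' ! k" if k: "k < K" for k
  proof -
    have "shifts (swap_keys \<omega> \<omega>') ! k = third N (request_at k \<omega>) (third N (shifts \<omega>' ! k) (request_at k \<omega>))"
      unfolding shifts_nth[OF k, of "swap_keys \<omega> \<omega>'"] using k by (simp add: swap_keys_def)
    also have "\<dots> = shifts \<omega>' ! k"
      by (intro third_simps(2) sample_simps(6) assms shifts_less k)
    finally show ?thesis .
  qed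
  then show "shifts (swap_keys \<omega> \<omega>') = shifts \<omega>'"
    by (intro nth_equalityI) (simp_all only: shifts_length)
  have "shifts (swap_requests \<omega> \<omega>') ! k = shifts \<omega>' ! k" if k: "k < K" for k
  proof -
    have "shifts (swap_requests \<omega> \<omega>') ! k =
        third N (third N (shifts \<omega>' ! k) (length (key_at k \<omega>))) (length (key_at k \<omega>))"
      unfolding shifts_nth[OF k, of "swap_requests \<omega> \<omega>'"] using k by (simp add: swap_requests_def)
    also have "\<dots> = shifts \<omega>' ! k"
      by (intro third_simps(4) sample_simps(4) assms shifts_less k)
    finally show ?thesis .
  qed
  then show "shifts (swap_requests \<omega> \<omega>') = shifts \<omega>'"
    by (intro nth_equalityI) (simp_all only: shifts_length)
qed

text \<open>The second swap takes files and shifts from a sample that has those of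
  \<open>\<omega>\<close>. Together with the demands or keys kept from \<open>\<omega>\<close> they
  determine the remaining component uniquely.\<close>

lemma swap_involution:
  assumes "\<omega> \<in> sample" "\<omega>' \<in> sample"
  shows "swap_keys (swap_keys \<omega> \<omega>') (swap_keys \<omega>' \<omega>) = \<omega>"
    and "swap_requests (swap_requests \<omega> \<omega>') (swap_requests \<omega>' \<omega>) = \<omega>"
proof -
  have "replicate (third N (shifts \<omega> ! k) (request_at k \<omega>)) True = key_at k \<omega>" if k: "k < K" for k
    using assms k sample_simps(5)[OF assms(1) k]
    by (simp add: shifts_nth[OF k] third_simps sample_simps)
  then have "map (\<lambda>k. replicate (third N (shifts \<omega> ! k) (request_at k \<omega>)) True) [0..<K] = fst (snd \<omega>)"
    using assms by (intro nth_equalityI) (auto simp: sample_simps)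
  then show "swap_keys (swap_keys \<omega> \<omega>') (swap_keys \<omega>' \<omega>) = \<omega>"
    unfolding swap_keys_def[of "swap_keys \<omega> \<omega>'"] shifts_swap(1)[OF assms(2,1)]
    by (simp add: swap_keys_def)
  have "third N (shifts \<omega> ! k) (length (key_at k \<omega>)) = request_at k \<omega>" if k: "k < K" for k
    using assms k by (simp add: shifts_nth[OF k] third_simps sample_simps)
  then have "map (\<lambda>k. third N (shifts \<omega> ! k) (length (key_at k \<omega>))) [0..<K] = snd (snd \<omega>)"
    using assms by (intro nth_equalityI) (auto simp: sample_simps)
  then show "swap_requests (swap_requests \<omega> \<omega>') (swap_requests \<omega>' \<omega>) = \<omega>"
    unfolding swap_requests_def[of "swap_requests \<omega> \<omega>'"] shifts_swap(2)[OF assms(2,1)]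
    by (simp add: swap_requests_def)
qed

text \<open>This is where the conditioning enters. The samples agree on demand and key of user
  \<open>k\<close>, so the recomputed component is the old one for this user; with the files of
  \<open>\<omega>'\<close> and the common key, the cache is that of \<open>\<omega>'\<close>, which
  equals that of \<open>\<omega>\<close>.\<close>

lemma cache_swap:
  assumes \<omega>: "\<omega> \<in> sample" "\<omega>' \<in> sample" and k: "k < K"
    and eq: "(request_at k \<omega>, cache_at k \<omega>) = (request_at k \<omega>', cache_at k \<omega>')"
  shows "(request_at k (swap_keys \<omega> \<omega>'), cache_at k (swap_keys \<omega> \<omega>')) = (request_at k \<omega>, cache_at k \<omega>)"
    and "(request_at k (swap_requests \<omega> \<omega>'), cache_at k (swap_requests \<omega> \<omega>')) = (request_at k \<omega>, cache_at k \<omega>)"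
proof -
  have len: "length (key_at k \<omega>) = length (key_at k \<omega>')"
    using cache_at_key_length[OF \<omega> k] eq by simp
  have req: "request_at k \<omega> = request_at k \<omega>'" using eq by simp
  have *: "third N (shifts \<omega>' ! k) (request_at k \<omega>') = length (key_at k \<omega>')"
    "third N (shifts \<omega>' ! k) (length (key_at k \<omega>')) = request_at k \<omega>'"
    using \<omega> k by (simp_all add: shifts_nth[OF k] third_simps sample_simps)
  have "cache_at k (swap_keys \<omega> \<omega>') = cache_at k \<omega>'"
    unfolding cache_at_eq_iff[OF swap_in_sample(1)[OF \<omega>] \<omega>(2) k]
    using k by (simp add: swap_keys_def req *)
  then show "(request_at k (swap_keys \<omega> \<omega>'), cache_at k (swap_keys \<omega> \<omega>')) = (request_at k \<omega>, cache_at k \<omega>)"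
    using eq by (simp add: swap_keys_def)
  have "cache_at k (swap_requests \<omega> \<omega>') = cache_at k \<omega>'"
    unfolding cache_at_eq_iff[OF swap_in_sample(2)[OF \<omega>] \<omega>(2) k]
    by (simp add: swap_requests_def len)
  then show "(request_at k (swap_requests \<omega> \<omega>'), cache_at k (swap_requests \<omega> \<omega>')) = (request_at k \<omega>, cache_at k \<omega>)"
    using eq k by (simp add: swap_requests_def len req *)
qed

lemma broadcast_swap:
  assumes \<omega>: "\<omega> \<in> sample" "\<omega>' \<in> sample"
  shows "broadcast_at (swap_keys \<omega> \<omega>') = broadcast_at \<omega>'"
    and "broadcast_at (swap_requests \<omega> \<omega>') = broadcast_at \<omega>'"
  using assms by (simp_all only: broadcast_at_eq_iff swap_in_sample shifts_swap)
    (simp_all add: swap_keys_def swap_requests_def)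

section \<open>Demand and cache privacy\<close>

lemma request_private:
  assumes k: "k < K"
  shows "sample.conditional_mutual_information 2 (count_space (tuple K request_at ` space sample.P))
    (count_space (broadcast_at ` space sample.P)) (count_space ((\<lambda>\<omega>. (request_at k \<omega>, cache_at k \<omega>)) ` space sample.P))
    (tuple K request_at) broadcast_at (\<lambda>\<omega>. (request_at k \<omega>, cache_at k \<omega>)) = 0"
proof (rule sample.conditional_mutual_information_eq_0[where \<sigma> = swap_keys])
  fix \<omega> \<omega>' assume \<omega>: "\<omega> \<in> sample" "\<omega>' \<in> sample"
    and Z: "(request_at k \<omega>, cache_at k \<omega>) = (request_at k \<omega>', cache_at k \<omega>')"
  show "swap_keys \<omega> \<omega>' \<in> sample" by (rule swap_in_sample[OF \<omega>])
  show "tuple K request_at (swap_keys \<omega> \<omega>') = tuple K request_at \<omega>"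
    by (simp add: tuple_def swap_keys_def)
  show "swap_keys (swap_keys \<omega> \<omega>') (swap_keys \<omega>' \<omega>) = \<omega>" by (rule swap_involution[OF \<omega>])
  show "broadcast_at (swap_keys \<omega> \<omega>') = broadcast_at \<omega>'" by (rule broadcast_swap[OF \<omega>])
  show "(request_at k (swap_keys \<omega> \<omega>'), cache_at k (swap_keys \<omega> \<omega>')) = (request_at k \<omega>, cache_at k \<omega>)"
    by (rule cache_swap[OF \<omega> k Z])
qed

lemma key_private:
  assumes k: "k < K"
  shows "sample.conditional_mutual_information 2 (count_space (tuple K key_at ` space sample.P))
    (count_space (broadcast_at ` space sample.P)) (count_space ((\<lambda>\<omega>. (request_at k \<omega>, cache_at k \<omega>)) ` space sample.P))
    (tuple K key_at) broadcast_at (\<lambda>\<omega>. (request_at k \<omega>, cache_at k \<omega>)) = 0"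
proof (rule sample.conditional_mutual_information_eq_0[where \<sigma> = swap_requests])
  fix \<omega> \<omega>' assume \<omega>: "\<omega> \<in> sample" "\<omega>' \<in> sample"
    and Z: "(request_at k \<omega>, cache_at k \<omega>) = (request_at k \<omega>', cache_at k \<omega>')"
  show "swap_requests \<omega> \<omega>' \<in> sample" by (rule swap_in_sample[OF \<omega>])
  show "tuple K key_at (swap_requests \<omega> \<omega>') = tuple K key_at \<omega>"
    by (simp add: tuple_def swap_requests_def)
  show "swap_requests (swap_requests \<omega> \<omega>') (swap_requests \<omega>' \<omega>) = \<omega>" by (rule swap_involution[OF \<omega>])
  show "broadcast_at (swap_requests \<omega> \<omega>') = broadcast_at \<omega>'" by (rule broadcast_swap[OF \<omega>])
  show "(request_at k (swap_requests \<omega> \<omega>'), cache_at k (swap_requests \<omega> \<omega>')) = (request_at k \<omega>, cache_at k \<omega>)"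
    by (rule cache_swap[OF \<omega> k Z])
qed

section \<open>Entropy bounds by counting values\<close>

lemma cache_entropy:
  assumes k: "k < K" and c: "\<And>v. v < N * K \<Longrightarrow> real N * card (cached_labels v) \<le> c"
  shows "sample.entropy 2 (count_space (cache_at k ` space sample.P)) (cache_at k) \<le> log 2 N + c"
proof -
  let ?A = "code (cache_values k) ` cache_values k"
  have "sample.entropy 2 (count_space (cache_at k ` space sample.P)) (cache_at k) \<le> log 2 (card ?A)"
  proof (rule sample.entropy_le_log_card)
    have "cache_at k \<omega> \<in> ?A" if "\<omega> \<in> sample" for \<omega>
      using cache_data_in[OF sample_simps(4)[OF that k]] that by (simp add: cache_at_eq)
    then show "cache_at k ` sample \<subseteq> ?A" by blast
  qed (use finite_cache_values in blast)
  also have "card ?A = card (cache_values k)"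
    by (intro card_image inj_on_code finite_cache_values)
  \<comment> \<open>For each of the N keys there are at most \<open>2 powr c\<close> contents; the
    factor N becomes the summand \<open>log 2 N\<close>.\<close>
  also have "real (card (cache_values k)) \<le> N * 2 powr c"
  proof -
    have "real (2 ^ (N * card (pos ` cached_labels (k * N + s)))) \<le> 2 powr c" if s: "s < N" for s
    proof -
      have "k * N + s < (k + 1) * N" using s by simp
      also have "\<dots> \<le> N * K" using k by (metis Suc_eq_plus1 Suc_leI mult.commute mult_le_mono1)
      finally have "real N * card (cached_labels (k * N + s)) \<le> c" by (rule c)
      moreover have "N * card (pos ` cached_labels (k * N + s)) \<le> N * card (cached_labels (k * N + s))"
        by (intro mult_le_mono2 card_image_le finite_cached_labels)
      then have "real (N * card (pos ` cached_labels (k * N + s))) \<le> real N * card (cached_labels (k * N + s))"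
        by (simp flip: of_nat_mult)
      ultimately have "real (N * card (pos ` cached_labels (k * N + s))) \<le> c" by simp
      then have "2 powr real (N * card (pos ` cached_labels (k * N + s))) \<le> 2 powr c"
        by (intro powr_mono) auto
      then show ?thesis by (simp add: powr_realpow del: of_nat_mult)
    qed
    then have "(\<Sum>s<N. real (2 ^ (N * card (pos ` cached_labels (k * N + s))))) \<le> (\<Sum>s<N. 2 powr c)"
      by (intro sum_mono) auto
    moreover have "card (cache_values k) = (\<Sum>s<N. 2 ^ (N * card (pos ` cached_labels (k * N + s))))"
      unfolding cache_values_def using finite_cached_labels
      by (subst card_SigmaI) (auto simp: card_Pow card_cartesian_product)
    ultimately show ?thesis by simp
  qed
  then have "log 2 (card (cache_values k)) \<le> log 2 (N * 2 powr c)"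
  proof (intro log_mono)
    \<comment> \<open>Only nonemptiness matters, so any file tuple will do.\<close>
    have "cache_data k 0 undefined \<in> cache_values k" using N_pos by (rule cache_data_in)
    then show "0 < real (card (cache_values k))"
      using finite_cache_values by (auto simp: card_gt_0_iff)
  qed auto
  also have "\<dots> = log 2 N + c" using N_pos by (simp add: log_mult log_powr)
  finally show ?thesis .
qed

text \<open>The summands are the cost of the shift vector, one bit per transmitted group, and one
  bit per file and unlabelled position.\<close>

lemma broadcast_entropy:
  "sample.entropy 2 (count_space (broadcast_at ` space sample.P)) broadcast_at \<le>
     K * log 2 N + card messages + real N * card uncoded"
proof -
  let ?A = "code broadcast_values ` broadcast_values"
  have "sample.entropy 2 (count_space (broadcast_at ` space sample.P)) broadcast_at \<le> log 2 (card ?A)"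
    using finite_broadcast_values
    by (intro sample.entropy_le_log_card)
      (auto simp: broadcast_at_eq simp del: mem_Collect_eq intro!: imageI broadcast_data_in public_in)
  also have "card ?A = card broadcast_values"
    by (intro card_image inj_on_code finite_broadcast_values)
  also have "log 2 (card broadcast_values) = K * log 2 N + card messages + real N * card uncoded"
    using N_pos by (simp add: card_broadcast_values log_mult log_nat_power)
  finally show ?thesis .
qed

lemma sample_private_caching_scheme:
  fixes mem load :: real
  assumes F: "0 < F"
    and c: "\<And>v. v < N * K \<Longrightarrow> real N * card (cached_labels v) \<le> c" "log 2 N + c \<le> mem * F"
    and r: "K * log 2 N + card messages + real N * card uncoded \<le> load * F"
  shows "private_caching_scheme sample.P N K F file_at key_at request_at scheme_cache scheme_broadcast mem load"
proof -
  interpret S: caching_system sample.P N K F file_at key_at request_at scheme_cache scheme_broadcast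
    by (intro caching_system.intro sample.information_space_axioms)
  have cache: "S.cache k = cache_at k" for k
    by (rule ext) (simp add: S.cache_def cache_at_def)
  have broadcast: "S.broadcast = broadcast_at"
    by (rule ext) (simp add: S.broadcast_def broadcast_at_def)
  have request: "sample.equidistributed (request_at k) {..<N}" if k: "k < K" for k
  proof -
    have "sample.equidistributed (\<lambda>\<omega>. tuple K request_at \<omega> ! k) {..<N}"
      using equidistributed_request k by (intro sample.equidistributed_coordinate) auto
    then show ?thesis using k by (simp add: tuple_def)
  qed
  have indep: "sample.indep_vars (\<lambda>_. count_space L) V {..<n}"
    if "sample.equidistributed (tuple n V) (words n L)" "finite L" for n L and V :: "nat \<Rightarrow> outcome \<Rightarrow> 'c"
  proof -
    have "sample.indep_vars (\<lambda>_. count_space L) (\<lambda>i \<omega>. tuple n V \<omega> ! i) {..<n}"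
      using that by (rule sample.equidistributed_indep_vars)
    moreover have "sample.indep_vars (\<lambda>_. count_space L) (\<lambda>i \<omega>. tuple n V \<omega> ! i) {..<n} \<longleftrightarrow>
        sample.indep_vars (\<lambda>_. count_space L) V {..<n}"
      by (rule sample.indep_vars_cong) (auto simp: tuple_def)
    ultimately show ?thesis by simp
  qed
  show ?thesis
  proof (intro private_caching_scheme.intro S.caching_system_axioms private_caching_scheme_axioms.intro)
    show "sample.indep_vars (\<lambda>_. count_space {w. length w = F}) file_at {..<N}"
      using equidistributed_file file_words(1) by (rule indep)
    show "simple_function sample.P (key_at k)" for k
      by (rule sample.simple_function_P)
    show "sample.indep_vars (\<lambda>_. count_space {..<N}) request_at {..<K}"
      using equidistributed_request by (rule indep) simp
    show "distr sample.P (count_space {..<N}) (request_at k) = uniform_count_measure {..<N}" if "k < K" for k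
      using request[OF that] by (rule sample.equidistributed_distr)
    have "S.Ent (tuple K key_at) = K * log 2 N"
      using sample.equidistributed_entropy[OF equidistributed_key] keys N_pos
      by (simp add: card_lists_length_eq log_nat_power)
    moreover have "S.Ent (request_at k) = log 2 N" if "k < K" for k
      using sample.equidistributed_entropy[OF request[OF that]] by simp
    moreover have "S.Ent (\<lambda>\<omega>. (tuple N file_at \<omega>, tuple K key_at \<omega>, tuple K request_at \<omega>)) =
        real N * real F + K * log 2 N + K * log 2 N"
      unfolding sample.equidistributed_entropy[OF equidistributed_joint] card_sample
      using N_pos by (simp add: log_mult log_nat_power)
    ultimately show "S.Ent (\<lambda>\<omega>. (tuple N file_at \<omega>, tuple K key_at \<omega>, tuple K request_at \<omega>)) =
        real N * real F + S.Ent (tuple K key_at) + (\<Sum>k<K. S.Ent (request_at k))"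
      by simp
    \<comment> \<open>Inverting the code yields the cached data, whose first component is the key;
      the metadata is its unary form.\<close>
    show "\<exists>g. \<forall>\<omega>\<in>space sample.P. key_at k \<omega> = g (S.cache k \<omega>)" if k: "k < K" for k
    proof (intro exI ballI)
      fix \<omega> assume "\<omega> \<in> space sample.P"
      then have \<omega>: "\<omega> \<in> sample" by (simp add: sample.space_P)
      have "the_inv_into (cache_values k) (code (cache_values k)) (cache_at k \<omega>) =
          cache_data k (length (key_at k \<omega>)) (fst \<omega>)"
        using \<omega> k by (simp add: cache_at_eq the_inv_into_f_f inj_on_code finite_cache_values
            cache_data_in sample_simps)
      then show "key_at k \<omega> = (\<lambda>z. replicate
          (fst (the_inv_into (cache_values k) (code (cache_values k)) z)) True) (S.cache k \<omega>)"
        using sample_simps(5)[OF \<omega> k] by (simp add: cache cache_data_def)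
    qed
    show "S.cond_Ent (\<lambda>\<omega>. file_at (request_at k \<omega>) \<omega>) (\<lambda>\<omega>. (request_at k \<omega>, S.cache k \<omega>, S.broadcast \<omega>)) = 0"
      if "k < K" for k
      unfolding cache broadcast using file_determined that
      by (intro sample.conditional_entropy_eq_0) blast
    show "S.cond_Info (tuple K request_at) S.broadcast (\<lambda>\<omega>. (request_at k \<omega>, S.cache k \<omega>)) = 0" if "k < K" for k
      unfolding cache broadcast using that by (rule request_private)
    show "S.cond_Info (tuple K key_at) S.broadcast (\<lambda>\<omega>. (request_at k \<omega>, S.cache k \<omega>)) = 0" if "k < K" for k
      unfolding cache broadcast using that by (rule key_private)
    show "S.Ent (S.cache k) \<le> mem * real F" if "k < K" for k
      unfolding cache using cache_entropy[OF that c(1)] c(2) by simp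
    show "S.Ent S.broadcast / real F \<le> load"
      unfolding broadcast using broadcast_entropy r F by (simp add: divide_le_eq)
  qed
qed

end

section \<open>Memory sharing\<close>

lemma convex_hull_image_weights:
  fixes f :: "'b \<Rightarrow> 'a::real_vector"
  assumes "finite A" "inj_on f A" "x \<in> convex hull (f ` A)"
  obtains u where "\<And>t. t \<in> A \<Longrightarrow> 0 \<le> u t" "sum u A = 1" "x = (\<Sum>t\<in>A. u t *\<^sub>R f t)"
proof -
  obtain w where w: "\<forall>x\<in>f ` A. 0 \<le> w x" "sum w (f ` A) = 1" "(\<Sum>x\<in>f ` A. w x *\<^sub>R x) = x"
    using assms convex_hull_finite[of "f ` A"] by auto
  show ?thesis
    by (rule that[of "w \<circ> f"]) (use w assms(2) in \<open>auto simp: sum.reindex\<close>)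
qed

text \<open>A fraction \<open>u t\<close> of every file is handled with parameter \<open>t\<close>; the bits lost by rounding are
  broadcast uncoded.\<close>

lemma achievable_weighted:
  fixes N K :: nat and u :: "nat \<Rightarrow> real"
  assumes N: "0 < N" and K: "0 < K"
    and u: "\<And>t. t \<le> N * K \<Longrightarrow> 0 \<le> u t" "(\<Sum>t\<le>N * K. u t) = 1"
  shows "achievable_load N K (\<Sum>t\<le>N * K. u t * (t / K))
    (\<Sum>t\<le>N * K. u t * ((real ((N * K) choose (t + 1)) - real ((N * K - N) choose (t + 1))) / real ((N * K) choose t)))"
    (is "achievable_load N K ?mem ?load")
  unfolding achievable_load_def
proof (intro allI impI)
  fix \<epsilon> :: real assume \<epsilon>: "0 < \<epsilon>"
  \<comment> \<open>Bounds the rounding loss per file: at level \<open>t\<close> less than one full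
    round of \<open>(N * K) choose t\<close> bits is lost.\<close>
  define c where "c = (\<Sum>t\<le>N * K. real ((N * K) choose t))"
  have "\<forall>\<^sub>F F in sequentially. a \<le> \<epsilon> * real F" for a
  proof -
    have "\<forall>\<^sub>F F in sequentially. a / \<epsilon> \<le> real F"
      using filterlim_real_sequentially by (simp add: filterlim_at_top)
    then show ?thesis
      by eventually_elim (use \<epsilon> in \<open>simp add: field_simps\<close>)
  qed
  \<comment> \<open>The overheads of cache and message do not grow with \<open>F\<close>, so both
    are eventually below \<open>\<epsilon> * F\<close>.\<close>
  from this[of "log 2 N"] this[of "K * log 2 N + N * c"] eventually_gt_at_top[of 0]
  show "\<forall>\<^sub>F F in sequentially. \<exists>(P :: outcome measure) W meta d \<phi> \<psi>.
      private_caching_scheme P N K F W meta d \<phi> \<psi> (?mem + \<epsilon>) (?load + \<epsilon>)"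
  proof eventually_elim
    fix F :: nat assume F: "log 2 N \<le> \<epsilon> * real F" "K * log 2 N + N * c \<le> \<epsilon> * real F" "0 < F"
    \<comment> \<open>A round at level \<open>t\<close> consumes one bit for every subset of size
      \<open>t\<close>; this is the number of whole rounds in the share
      \<open>u t * F\<close>.\<close>
    define m where "m t = nat \<lfloor>u t * F / ((N * K) choose t)\<rfloor>" for t
    have binom: "real ((N * K) choose t) > 0" if "t \<le> N * K" for t
      using that by simp
    have m_real: "real (m t) \<le> u t * F / ((N * K) choose t)" "u t * F / ((N * K) choose t) \<le> real (m t) + 1"
      if "t \<le> N * K" for t
    proof -
      have "0 \<le> u t * F / ((N * K) choose t)" using u(1)[OF that] by simp
      then have "real (m t) = of_int \<lfloor>u t * F / ((N * K) choose t)\<rfloor>"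
        by (simp add: m_def)
      then show "real (m t) \<le> u t * F / ((N * K) choose t)" "u t * F / ((N * K) choose t) \<le> real (m t) + 1"
        by linarith+
    qed
    have m_le: "real (m t) * ((N * K) choose t) \<le> u t * F" if "t \<le> N * K" for t
      using m_real(1)[OF that] binom[OF that] by (simp add: field_simps)
    have m_ge: "u t * F \<le> real (m t) * ((N * K) choose t) + ((N * K) choose t)" if "t \<le> N * K" for t
      using m_real(2)[OF that] binom[OF that] by (simp add: field_simps)
    \<comment> \<open>\<open>pos\<close> stays open: the labels and their number do not depend on
      it, and a placement can be chosen only once they are known to fit into the file.\<close>
    interpret L: virtual_user_scheme N K F m pos for pos
      using N K by unfold_locales
    have card_L: "real (card L.labels) = (\<Sum>t\<le>N * K. real (m t) * ((N * K) choose t))"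
      by (simp add: L.card_labels)
    also have "\<dots> \<le> (\<Sum>t\<le>N * K. u t * F)" using m_le by (intro sum_mono) auto
    also have "\<dots> = F" using u(2) by (simp flip: sum_distrib_right)
    finally have "card L.labels \<le> card {..<F}" by simp
    \<comment> \<open>Injectivity makes the unlabelled remainder exactly
      \<open>F - card L.labels\<close>.\<close>
    then obtain pos where pos: "pos ` L.labels \<subseteq> {..<F}" "inj_on pos L.labels"
      using card_le_inj[OF L.finite_labels] by blast
    have "real N * card (L.cached_labels v) \<le> ?mem * F" if "v < N * K" for v
    proof -
      have "(\<Sum>t\<le>N * K. m t * (real t / K * (N * K choose t))) \<le> (\<Sum>t\<le>N * K. u t * (t / K) * F)"
      proof (rule sum_mono)
        fix t assume "t \<in> {..N * K}"
        then show "m t * (real t / K * (N * K choose t)) \<le> u t * (t / K) * F"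
          using mult_right_mono[OF m_le[of t], of "t / K"] by (simp add: mult_ac)
      qed
      then show ?thesis by (simp add: L.card_cached_labels[OF that] sum_distrib_right)
    qed
    moreover have "log 2 N + ?mem * F \<le> (?mem + \<epsilon>) * F"
      using F(1) by (simp add: distrib_right)
    moreover have "K * log 2 N + card L.messages + real N * card (L.uncoded pos) \<le> (?load + \<epsilon>) * F"
    proof -
      have "real (card L.messages) \<le> ?load * F"
        unfolding L.card_messages sum_distrib_right
      proof (rule sum_mono)
        fix t assume "t \<in> {..N * K}"
        then have t: "t \<le> N * K" by simp
        \<comment> \<open>Since the numerator is nonnegative, rounding down the number of rounds can
          only lower the coded load.\<close>
        have "0 \<le> real ((N * K) choose (t + 1)) - real ((N * K - N) choose (t + 1))"
          by (simp add: binomial_right_mono)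
        from mult_right_mono[OF m_real(1)[OF t] this]
        show "m t * (real ((N * K) choose (t + 1)) - real ((N * K - N) choose (t + 1))) \<le>
          u t * ((real ((N * K) choose (t + 1)) - real ((N * K - N) choose (t + 1))) / real ((N * K) choose t)) * F"
          by (simp add: mult_ac)
      qed
      moreover have "real (card (L.uncoded pos)) \<le> c"
      proof -
        have "card (L.uncoded pos) = F - card L.labels"
          unfolding L.uncoded_def using pos
          by (subst card_Diff_subset) (auto simp: card_image intro: finite_subset)
        then have "real (card (L.uncoded pos)) = F - (\<Sum>t\<le>N * K. real (m t) * ((N * K) choose t))"
          using \<open>card L.labels \<le> card {..<F}\<close> by (simp add: card_L)
        also have "real F = (\<Sum>t\<le>N * K. u t * F)" using u(2) by (simp flip: sum_distrib_right)
        also have "\<dots> - (\<Sum>t\<le>N * K. real (m t) * ((N * K) choose t)) =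
            (\<Sum>t\<le>N * K. u t * F - real (m t) * ((N * K) choose t))"
          by (simp add: sum_subtractf)
        also have "\<dots> \<le> c" unfolding c_def using m_ge by (intro sum_mono) (simp add: diff_le_eq add.commute)
        finally show ?thesis .
      qed
      then have "real N * card (L.uncoded pos) \<le> N * c" by (intro mult_left_mono) auto
      ultimately show ?thesis using F(2) by (simp add: distrib_right)
    qed
    ultimately show "\<exists>(P :: outcome measure) W meta d \<phi> \<psi>.
        private_caching_scheme P N K F W meta d \<phi> \<psi> (?mem + \<epsilon>) (?load + \<epsilon>)"
      using L.sample_private_caching_scheme[OF F(3)] by blast
  qed
qed

theorem theorem3:
  fixes N K :: nat and M :: real
  assumes "N \<ge> 1" and "K \<ge> 1"
  shows "minimum_load N K M \<le>
    lower_convex_envelope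
      ((\<lambda>t. (real t / real K,
              (real ((N * K) choose (t + 1)) - real ((N * K - N) choose (t + 1)))
                / real ((N * K) choose t))) ` {0..N * K}) M"
  (is "_ \<le> lower_convex_envelope (?f ` _) _")
  unfolding lower_convex_envelope_def
proof (rule INF_greatest)
  fix y assume "y \<in> {y. (M, y) \<in> convex hull (?f ` {0..N * K})}"
  then have "(M, y) \<in> convex hull (?f ` {0..N * K})" by simp
  \<comment> \<open>The memory coordinates \<open>t / K\<close> are already distinct, so the weights
    can be indexed by \<open>t\<close>.\<close>
  moreover have "inj_on ?f {0..N * K}"
    using assms by (auto simp: inj_on_def)
  ultimately obtain u where u: "\<And>t. t \<in> {0..N * K} \<Longrightarrow> 0 \<le> u t" "sum u {0..N * K} = 1"
    "(M, y) = (\<Sum>t\<in>{0..N * K}. u t *\<^sub>R ?f t)"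
    using convex_hull_image_weights[of "{0..N * K}" ?f "(M, y)"] by auto
  have "M = fst (\<Sum>t\<in>{0..N * K}. u t *\<^sub>R ?f t)" "y = snd (\<Sum>t\<in>{0..N * K}. u t *\<^sub>R ?f t)"
    using u(3) by (metis fst_conv, metis snd_conv)
  then have "achievable_load N K M y"
    using achievable_weighted[of N K u] u(1,2) assms
    by (simp add: fst_sum snd_sum atLeast0AtMost)
  then show "minimum_load N K M \<le> ereal y"
    unfolding minimum_load_def by (intro INF_lower) simp
qed

end
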